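(* Let ${\mathcal R}$ be a similarity relation, $\mu$ a cut value, and $t,s$ higher-order patterns. If there exists an $({\mathcal R},\mu)$-unifier $\tau$ of $t$ and $s$ with degree $\mathfrak{d}_\tau\ge\mu$, then $\mathsf{HOPSU}$, started on $\{t\simeq^?_{{\mathcal R},\mu}s\};\varepsilon;1$, stops with a configuration $\emptyset;\sigma;\mathfrak{d}$ such that $\sigma\preceq^{\mathit{Dom}(\tau)}_{{\mathcal R},\mu}\tau$ and $\mathfrak{d}\ge\mathfrak{d}_\tau$.
   Context: Terms: simply typed $\lambda$-terms over disjoint countably infinite sets $\mathcal{V}$ (typed variables) and $\mathcal{F}$ (typed constants), types $\tau::=\delta\mid\tau\to\tau$. Terms are identified modulo $\alpha$, kept $\beta$-normal, and $\eta$-expanded except that arguments of free variables are kept $\eta$-normal (i.e. are bound variables); a term is written $\lambda x_1,\dots,x_n.h(t_1,\dots,t_m)$ with head $h$. Free variables are written $F,G,H,X,Y,\dots$, bound variables $x,y,z,\dots$. A higher-order pattern is a term where every free variable occurrence is applied to a list of pairwise distinct bound variables; all terms in problems and substitutions are higher-order patterns. Substitutions $\sigma$ are type-preserving maps with finite domain $\mathit{Dom}(\sigma)=\{X\mid X\sigma\neq X\}$, applied postfix ($t\sigma$, capture-avoiding, followed by $\beta$-normalization); $\sigma\vartheta$ means first $\sigma$ then $\vartheta$; $\varepsilon$ is the identity; $\varphi|_V$ is the restriction to $V$; $\mathtt{fv}(t)$ is the set of free variables. Fuzzy setting: T-norm $\wedge=\min$. ${\mathcal R}_A$ is a similarity relation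 (reflexive, symmetric, min-transitive map to $[0,1]$) on $\mathcal{F}\cup\mathcal{V}$ with ${\mathcal R}_A(x,y)=0$ for distinct variables, ${\mathcal R}_A(f,g)=0$ for constants of different types, ${\mathcal R}_A(x,f)=0$ for a variable and a constant. It induces ${\mathcal R}$ on terms: on normal forms ${\mathcal R}(a,b)={\mathcal R}_A(a,b)$ for symbols, ${\mathcal R}((t_1\,s_1),(t_2\,s_2))={\mathcal R}(t_1,t_2)\wedge{\mathcal R}(s_1,s_2)$, ${\mathcal R}(\lambda x.t,\lambda y.s)={\mathcal R}(t\{x\mapsto z\},s\{y\mapsto z\})$ for fresh $z$ of the same type, $0$ otherwise. A cut value is $\mu\in(0,1]$. Write $t\simeq_{{\mathcal R},\mu}s$ iff ${\mathcal R}(t,s)\ge\mu$. For a set of variables $V$, $\sigma\preceq^V_{{\mathcal R},\mu}\vartheta$ iff there is a substitution $\psi$ with $X\sigma\psi\simeq_{{\mathcal R},\mu}X\vartheta$ for all $X\in V$. An equation is written $t\simeq^?_{{\mathcal R},\mu}s$; a unification problem is a finite set of equations. A substitution $\sigma$ is an $({\mathcal R},\mu)$-unifier of $\{t_1\simeq^?_{{\mathcal R},\mu}s_1,\dots,t_n\simeq^?_{{\mathcal R},\mu}s_n\}$ with degree $\mathfrak{d}$ if ${\mathcal R}(t_1\sigma,s_1\sigma)\wedge\dots\wedge{\mathcal R}(t_n\sigma,s_n\sigma)=\mathfrak{d}\ge\mu$; a unifier of $t$ and $s$ is a unifier of $\{t\simeq^?_{{\mathcal R},\mu}s\}$. Algorithm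 $\mathsf{HOPSU}$: it works on configurations $P;\sigma;\mathfrak{d}$ ($P$ a problem, $\sigma$ a substitution, $\mathfrak{d}\ge\mu$ a degree) or $\bot$, applying the following rules to a selected equation as long as possible ($\uplus$ is disjoint union): (Abs) $\{\lambda x.t\simeq^?\lambda x.s\}\uplus P;\sigma;\mathfrak{d}\leadsto\{t\simeq^?s\}\cup P;\sigma;\mathfrak{d}$. (Dec) $\{f(t_1,\dots,t_n)\simeq^?g(s_1,\dots,s_n)\}\uplus P;\sigma;\mathfrak{d}\leadsto\{t_1\simeq^?s_1,\dots,t_n\simeq^?s_n\}\cup P;\sigma;\mathfrak{d}\wedge{\mathcal R}(f,g)$, where $f,g$ are rigid heads, $n\ge0$, and $\mathfrak{d}\wedge{\mathcal R}(f,g)\ge\mu$. (SV) $\{F(x_1,\dots,x_n)\simeq^?F(y_1,\dots,y_n)\}\uplus P;\sigma;\mathfrak{d}\leadsto P\vartheta;\sigma\vartheta;\mathfrak{d}$, where $\{z_1,\dots,z_m\}=\{x_i\mid x_i=y_i\}$ and $\vartheta=\{F\mapsto\lambda x_1,\dots,x_n.H(z_1,\dots,z_m)\}$ with $H$ fresh. (Ori) $\{a(s_1,\dots,s_m)\simeq^?F(x_1,\dots,x_n)\}\uplus P;\sigma;\mathfrak{d}\leadsto\{F(x_1,\dots,x_n)\simeq^?a(s_1,\dots,s_m)\}\cup P;\sigma;\mathfrak{d}$, where $F$ is free and $a$ is a constant or $a\in\{x_1,\dots,x_n\}$. (LF) $\{F(x_1,\dots,x_n)\simeq^?a(s_1,\dots,s_m)\}\uplus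 P;\sigma;\mathfrak{d}\leadsto P\vartheta;\sigma\vartheta;\mathfrak{d}$, where $F\notin\mathtt{fv}(a(s_1,\dots,s_m))$, $a$ is a constant, a free variable, or in $\{x_1,\dots,x_n\}$, $\mathsf{VarElim}(F(x_1,\dots,x_n),a(s_1,\dots,s_m))=\varphi$, and $\vartheta=\varphi|_V$ with $V=\{F\}\cup\mathtt{fv}(a(s_1,\dots,s_m))$. (Fail) $\{t\simeq^?s\}\uplus P;\sigma;\mathfrak{d}\leadsto\bot$ if no other rule applies to the selected equation. $\mathsf{VarElim}(t,s)$ starts from $\{t\simeq^?s\};\varepsilon$ and applies as long as possible: (VE1) $\{F(x_1,\dots,x_n)\simeq^?a(s_1,\dots,s_m)\}\uplus P;\sigma\leadsto\{H_1(x_1,\dots,x_n)\simeq^?s_1,\dots,H_m(x_1,\dots,x_n)\simeq^?s_m\}\cup P;\sigma\vartheta$, where $a$ is a constant or in $\{x_1,\dots,x_n\}$, $\vartheta=\{F\mapsto\lambda x_1,\dots,x_n.a(H_1(x_1,\dots,x_n),\dots,H_m(x_1,\dots,x_n))\}$ with $H_i$ fresh of appropriate types; (VE2) $\{F(x_1,\dots,x_n)\simeq^?G(y_1,\dots,y_m)\}\uplus P;\sigma\leadsto P\vartheta;\sigma\vartheta$, where $\{x_1,\dots,x_n\}\cap\{y_1,\dots,y_m\}=\{z_1,\dots,z_k\}$ and $\vartheta=\{F\mapsto\lambda x_1,\dots,x_n.H(z_1,\dots,z_k),G\mapsto\lambda y_1,\dots,y_m.H(z_1,\dots,z_k)\}$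 with $H$ fresh. If it ends in $\emptyset;\varphi$, then $\mathsf{VarElim}(t,s)=\varphi$.
   Formalization: VarElim is given an extra rule stripping equal leading binders (without it, F ≃? f(λy.a) gets stuck although unifiable), and fresh variables must also avoid Dom(τ) (otherwise σ need not be more general than τ on Dom(τ)). *)

theory Defs
  imports Complex_Main
begin

datatype ty = Base nat | Fun ty ty

(* typed constants and typed free variables: a name together with its type;
   for every type there are countably many of each *)
type_synonym const = "nat \<times> ty"
type_synonym var = "nat \<times> ty"

(* heads: constants, free variables, bound variables (de Bruijn index,
   annotated with the type of the binder it refers to) *)
datatype hd = C const | FV var | BV nat ty

(* a term lambda x1..xn. h(t1,..,tm) is  Lam T1 (... (Lam Tn (Ap h [t1,..,tm]))) ;
   since heads are symbols, every such term is beta-normal *)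
datatype trm = Lam ty trm | Ap hd "trm list"

fun arrows :: "ty list \<Rightarrow> ty \<Rightarrow> ty" where
  "arrows [] U = U"
| "arrows (T # Ts) U = Fun T (arrows Ts U)"

fun argtys :: "ty \<Rightarrow> ty list" where
  "argtys (Base b) = []"
| "argtys (Fun A B) = A # argtys B"

fun resty :: "ty \<Rightarrow> ty" where
  "resty (Base b) = Base b"
| "resty (Fun A B) = resty B"

fun headty :: "hd \<Rightarrow> ty" where
  "headty (C c) = snd c"
| "headty (FV X) = snd X"
| "headty (BV i T) = T"

fun dropty :: "nat \<Rightarrow> ty \<Rightarrow> ty" where
  "dropty 0 T = T"
| "dropty (Suc n) (Fun A B) = dropty n B"
| "dropty (Suc n) (Base b) = Base b"

fun typeof :: "trm \<Rightarrow> ty" where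
  "typeof (Lam T t) = Fun T (typeof t)"
| "typeof (Ap h ts) = dropty (length ts) (headty h)"

(* hopat \<Gamma> t T : t is an eta-long (except arguments of free variables, which are
   eta-normal bound variables) higher-order pattern of type T in the context \<Gamma>
   of binder types (innermost binder first) *)
inductive hopat :: "ty list \<Rightarrow> trm \<Rightarrow> ty \<Rightarrow> bool" where
  pat_lam: "hopat (T # \<Gamma>) t U \<Longrightarrow> hopat \<Gamma> (Lam T t) (Fun T U)"
| pat_const: "\<lbrakk> length ts = length Ts; \<forall>i<length ts. hopat \<Gamma> (ts ! i) (Ts ! i);
               snd c = arrows Ts (Base b) \<rbrakk> \<Longrightarrow> hopat \<Gamma> (Ap (C c) ts) (Base b)"
| pat_bound: "\<lbrakk> i < length \<Gamma>; \<Gamma> ! i = S; S = arrows Ts (Base b);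
               length ts = length Ts; \<forall>k<length ts. hopat \<Gamma> (ts ! k) (Ts ! k) \<rbrakk>
               \<Longrightarrow> hopat \<Gamma> (Ap (BV i S) ts) (Base b)"
| pat_free: "\<lbrakk> distinct (map fst js); \<forall>(j, S) \<in> set js. j < length \<Gamma> \<and> \<Gamma> ! j = S;
              snd X = arrows (map snd js) (Base b) \<rbrakk>
              \<Longrightarrow> hopat \<Gamma> (Ap (FV X) (map (\<lambda>(j, S). Ap (BV j S) []) js)) (Base b)"

fun fvh :: "hd \<Rightarrow> var set" where
  "fvh (FV X) = {X}"
| "fvh (C c) = {}"
| "fvh (BV i T) = {}"

fun fv :: "trm \<Rightarrow> var set" where
  "fv (Lam T t) = fv t"
| "fv (Ap h ts) = fvh h \<union> \<Union> (set (map fv ts))"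

fun renh :: "(nat \<Rightarrow> nat) \<Rightarrow> nat \<Rightarrow> hd \<Rightarrow> hd" where
  "renh f d (BV i T) = (if i < d then BV i T else BV (f (i - d) + d) T)"
| "renh f d (C c) = C c"
| "renh f d (FV X) = FV X"

fun ren :: "(nat \<Rightarrow> nat) \<Rightarrow> nat \<Rightarrow> trm \<Rightarrow> trm" where
  "ren f d (Lam T t) = Lam T (ren f (Suc d) t)"
| "ren f d (Ap h ts) = Ap (renh f d h) (map (ren f d) ts)"

definition lift :: "nat \<Rightarrow> trm \<Rightarrow> trm" where
  "lift k t = ren (\<lambda>i. i + k) 0 t"

fun is_bvatom :: "trm \<Rightarrow> bool" where
  "is_bvatom (Ap (BV i T) []) = True"
| "is_bvatom _ = False"

fun bidx :: "trm \<Rightarrow> nat" where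
  "bidx (Ap (BV i T) []) = i"
| "bidx _ = 0"

fun strip :: "nat \<Rightarrow> trm \<Rightarrow> trm" where
  "strip 0 t = t"
| "strip (Suc n) (Lam T t) = strip n t"
| "strip (Suc n) t = t"

definition mk_abs :: "ty list \<Rightarrow> trm \<Rightarrow> trm" where
  "mk_abs Ts u = foldr Lam Ts u"

(* the bound variables x1..xn of lambda x1..xn (types Ts), seen at depth 0 of the body *)
definition canon :: "ty list \<Rightarrow> trm list" where
  "canon Ts = map (\<lambda>i. Ap (BV (length Ts - 1 - i) (Ts ! i)) []) [0..<length Ts]"

type_synonym subst = "var \<Rightarrow> trm"

(* application of a substitution to a pattern followed by beta-normalisation:
   X(y1..yn) with X \<mapsto> lambda x1..xn. u becomes u{x1 \<mapsto> y1,..,xn \<mapsto> yn} *)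
fun sapp :: "subst \<Rightarrow> trm \<Rightarrow> trm" where
  "sapp \<sigma> (Lam T t) = Lam T (sapp \<sigma> t)"
| "sapp \<sigma> (Ap h ts) =
     (case h of
        FV X \<Rightarrow>
          (if (\<forall>t \<in> set ts. is_bvatom t)
           then ren (\<lambda>i. if i < length ts then bidx (ts ! (length ts - 1 - i)) else i - length ts) 0
                    (strip (length ts) (\<sigma> X))
           else Ap h (map (sapp \<sigma>) ts))
      | _ \<Rightarrow> Ap h (map (sapp \<sigma>) ts))"

definition eta_var :: "var \<Rightarrow> trm" where
  "eta_var X = mk_abs (argtys (snd X)) (Ap (FV X) (canon (argtys (snd X))))"

definition eps :: subst where
  "eps = eta_var"

definition Dom :: "subst \<Rightarrow> var set" where
  "Dom \<sigma> = {X. \<sigma> X \<noteq> eta_var X}"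

definition comp :: "subst \<Rightarrow> subst \<Rightarrow> subst" where
  "comp \<sigma> \<theta> = (\<lambda>X. sapp \<theta> (\<sigma> X))"

definition restrict :: "subst \<Rightarrow> var set \<Rightarrow> subst" where
  "restrict \<phi> V = (\<lambda>X. if X \<in> V then \<phi> X else eta_var X)"

definition is_subst :: "subst \<Rightarrow> bool" where
  "is_subst \<sigma> \<longleftrightarrow> finite (Dom \<sigma>) \<and> (\<forall>X. hopat [] (\<sigma> X) (snd X))"

definition similarity :: "(const \<Rightarrow> const \<Rightarrow> real) \<Rightarrow> bool" where
  "similarity Rc \<longleftrightarrow>
     (\<forall>f g. 0 \<le> Rc f g \<and> Rc f g \<le> 1) \<and>
     (\<forall>f. Rc f f = 1) \<and>
     (\<forall>f g. Rc f g = Rc g f) \<and>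
     (\<forall>f g h. min (Rc f g) (Rc g h) \<le> Rc f h) \<and>
     (\<forall>f g. snd f \<noteq> snd g \<longrightarrow> Rc f g = 0)"

fun RA :: "(const \<Rightarrow> const \<Rightarrow> real) \<Rightarrow> hd \<Rightarrow> hd \<Rightarrow> real" where
  "RA Rc (C f) (C g) = Rc f g"
| "RA Rc (FV X) (FV Y) = (if X = Y then 1 else 0)"
| "RA Rc (BV i T) (BV j U) = (if i = j \<and> T = U then 1 else 0)"
| "RA Rc _ _ = 0"

fun Rt :: "(const \<Rightarrow> const \<Rightarrow> real) \<Rightarrow> trm \<Rightarrow> trm \<Rightarrow> real"
and Rl :: "(const \<Rightarrow> const \<Rightarrow> real) \<Rightarrow> trm list \<Rightarrow> trm list \<Rightarrow> real" where
  "Rt Rc (Lam T t) (Lam U s) = (if T = U then Rt Rc t s else 0)"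
| "Rt Rc (Ap h ts) (Ap g ss) = (if length ts = length ss then min (RA Rc h g) (Rl Rc ts ss) else 0)"
| "Rt Rc (Lam T t) (Ap g ss) = 0"
| "Rt Rc (Ap h ts) (Lam U s) = 0"
| "Rl Rc [] [] = 1"
| "Rl Rc (t # ts) (s # ss) = min (Rt Rc t s) (Rl Rc ts ss)"
| "Rl Rc _ _ = 0"

definition more_general :: "(const \<Rightarrow> const \<Rightarrow> real) \<Rightarrow> real \<Rightarrow> var set \<Rightarrow> subst \<Rightarrow> subst \<Rightarrow> bool" where
  "more_general Rc \<mu> V \<sigma> \<theta> \<longleftrightarrow> (\<exists>\<psi>. is_subst \<psi> \<and> (\<forall>X\<in>V. Rt Rc (sapp \<psi> (\<sigma> X)) (\<theta> X) \<ge> \<mu>))"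

definition unifier_deg :: "(const \<Rightarrow> const \<Rightarrow> real) \<Rightarrow> real \<Rightarrow> subst \<Rightarrow> trm \<Rightarrow> trm \<Rightarrow> real \<Rightarrow> bool" where
  "unifier_deg Rc \<mu> \<sigma> t s d \<longleftrightarrow> Rt Rc (sapp \<sigma> t) (sapp \<sigma> s) = d \<and> d \<ge> \<mu>"

type_synonym eqn = "trm \<times> trm"

definition Papp :: "subst \<Rightarrow> eqn set \<Rightarrow> eqn set" where
  "Papp \<theta> P = (\<lambda>(a, b). (sapp \<theta> a, sapp \<theta> b)) ` P"

definition cvars :: "eqn set \<Rightarrow> subst \<Rightarrow> var set" where
  "cvars P \<sigma> = (\<Union>(a, b)\<in>P. fv a \<union> fv b) \<union> Dom \<sigma> \<union> (\<Union>X\<in>Dom \<sigma>. fv (\<sigma> X))"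

fun pos :: "'a list \<Rightarrow> 'a \<Rightarrow> nat" where
  "pos [] a = 0"
| "pos (x # xs) a = (if x = a then 0 else Suc (pos xs a))"

(* lambda x1..xn. u, where xs are the (loose) bound-variable atoms x1..xn
   occurring in u and Ts their types *)
definition abstr :: "ty list \<Rightarrow> trm list \<Rightarrow> trm \<Rightarrow> trm" where
  "abstr Ts xs u = mk_abs Ts (ren (\<lambda>i. length xs - 1 - pos (map bidx xs) i) 0 u)"

(* eta-long form of H(x1,..,xn) of type T (H has type types(xs) \<Rightarrow> T) *)
definition eta_app :: "var \<Rightarrow> trm list \<Rightarrow> ty \<Rightarrow> trm" where
  "eta_app H xs T = mk_abs (argtys T)
     (Ap (FV H) (map (lift (length (argtys T))) xs @ canon (argtys T)))"

definition single :: "var \<Rightarrow> trm \<Rightarrow> subst" where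
  "single F u = (eta_var(F := u))"

definition rigid :: "hd \<Rightarrow> bool" where
  "rigid h \<longleftrightarrow> (\<exists>c. h = C c) \<or> (\<exists>i T. h = BV i T)"

inductive ve_step :: "var set \<Rightarrow> eqn set \<times> subst \<Rightarrow> eqn set \<times> subst \<Rightarrow> bool"
  for A :: "var set" where
  ve_abs: "\<lbrakk> e = (Lam T t, Lam T s); e \<in> Q \<rbrakk>
     \<Longrightarrow> ve_step A (Q, \<phi>) (insert (t, s) (Q - {e}), \<phi>)"
| ve1: "\<lbrakk> e = (Ap (FV F) xs, Ap a ss); e \<in> Q; \<forall>x\<in>set xs. is_bvatom x;
          (\<exists>c. a = C c) \<or> (\<exists>j S. a = BV j S \<and> Ap a [] \<in> set xs);
          length Hs = length ss; distinct Hs;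
          \<forall>H\<in>set Hs. H \<notin> A \<union> cvars Q \<phi>;
          \<forall>i<length ss. snd (Hs ! i) = arrows (map typeof xs) (argtys (headty a) ! i);
          Ts = argtys (snd F);
          \<theta> = single F (abstr Ts xs
                  (Ap a (map (\<lambda>i. eta_app (Hs ! i) xs (argtys (headty a) ! i)) [0..<length ss])));
          Q' = set (map (\<lambda>i. (eta_app (Hs ! i) xs (argtys (headty a) ! i), ss ! i)) [0..<length ss])
               \<union> (Q - {e}) \<rbrakk>
     \<Longrightarrow> ve_step A (Q, \<phi>) (Q', comp \<phi> \<theta>)"
| ve2: "\<lbrakk> e = (Ap (FV F) xs, Ap (FV G) ys); e \<in> Q; F \<noteq> G;
          \<forall>x\<in>set xs. is_bvatom x; \<forall>y\<in>set ys. is_bvatom y;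
          zs = filter (\<lambda>x. x \<in> set ys) xs;
          H \<notin> A \<union> cvars Q \<phi>;
          snd H = arrows (map typeof zs) (resty (snd F));
          \<theta> = (eta_var(F := abstr (argtys (snd F)) xs (Ap (FV H) zs),
                          G := abstr (argtys (snd G)) ys (Ap (FV H) zs))) \<rbrakk>
     \<Longrightarrow> ve_step A (Q, \<phi>) (Papp \<theta> (Q - {e}), comp \<phi> \<theta>)"

definition var_elim :: "var set \<Rightarrow> trm \<Rightarrow> trm \<Rightarrow> subst \<Rightarrow> bool" where
  "var_elim A t s \<phi> \<longleftrightarrow> (ve_step A)\<^sup>*\<^sup>* ({(t, s)}, eps) ({}, \<phi>)"

datatype config = Conf "eqn set" subst real | Bot

(* the non-failing rules applied to the selected equation e, with the remaining problem P;
   W is a set of variables that fresh variables must avoid *)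
inductive hstep0 :: "(const \<Rightarrow> const \<Rightarrow> real) \<Rightarrow> real \<Rightarrow> var set \<Rightarrow> eqn \<Rightarrow> eqn set \<Rightarrow> subst \<Rightarrow> real \<Rightarrow> config \<Rightarrow> bool"
  for Rc :: "const \<Rightarrow> const \<Rightarrow> real" and \<mu> :: real and W :: "var set" where
  Abs: "e = (Lam T t, Lam T s) \<Longrightarrow> hstep0 Rc \<mu> W e P \<sigma> d (Conf (insert (t, s) P) \<sigma> d)"
| Dec: "\<lbrakk> e = (Ap f ts, Ap g ss); rigid f; rigid g; length ts = length ss;
          min d (RA Rc f g) \<ge> \<mu> \<rbrakk>
     \<Longrightarrow> hstep0 Rc \<mu> W e P \<sigma> d (Conf (set (zip ts ss) \<union> P) \<sigma> (min d (RA Rc f g)))"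
| SV: "\<lbrakk> e = (Ap (FV F) xs, Ap (FV F) ys); length xs = length ys;
         \<forall>x\<in>set xs. is_bvatom x; \<forall>y\<in>set ys. is_bvatom y;
         zs = map fst (filter (\<lambda>(x, y). x = y) (zip xs ys));
         H \<notin> W \<union> cvars (insert e P) \<sigma>;
         snd H = arrows (map typeof zs) (resty (snd F));
         \<theta> = single F (abstr (argtys (snd F)) xs (Ap (FV H) zs)) \<rbrakk>
     \<Longrightarrow> hstep0 Rc \<mu> W e P \<sigma> d (Conf (Papp \<theta> P) (comp \<sigma> \<theta>) d)"
| Ori: "\<lbrakk> e = (Ap a ss, Ap (FV F) xs); \<forall>x\<in>set xs. is_bvatom x;
          (\<exists>c. a = C c) \<or> (\<exists>j S. a = BV j S \<and> Ap a [] \<in> set xs) \<rbrakk>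
     \<Longrightarrow> hstep0 Rc \<mu> W e P \<sigma> d (Conf (insert (Ap (FV F) xs, Ap a ss) P) \<sigma> d)"
| LF: "\<lbrakk> e = (Ap (FV F) xs, u); u = Ap a ss; \<forall>x\<in>set xs. is_bvatom x; F \<notin> fv u;
         (\<exists>c. a = C c) \<or> (\<exists>G. a = FV G) \<or> (\<exists>j S. a = BV j S \<and> Ap a [] \<in> set xs);
         var_elim (W \<union> cvars (insert e P) \<sigma>) (Ap (FV F) xs) u \<phi>;
         \<theta> = restrict \<phi> ({F} \<union> fv u) \<rbrakk>
     \<Longrightarrow> hstep0 Rc \<mu> W e P \<sigma> d (Conf (Papp \<theta> P) (comp \<sigma> \<theta>) d)"

inductive hstep :: "(const \<Rightarrow> const \<Rightarrow> real) \<Rightarrow> real \<Rightarrow> var set \<Rightarrow> config \<Rightarrow> config \<Rightarrow> bool"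
  for Rc :: "const \<Rightarrow> const \<Rightarrow> real" and \<mu> :: real and W :: "var set" where
  rule: "\<lbrakk> e \<in> P; hstep0 Rc \<mu> W e (P - {e}) \<sigma> d c' \<rbrakk> \<Longrightarrow> hstep Rc \<mu> W (Conf P \<sigma> d) c'"
| Fail: "\<lbrakk> e \<in> P; \<not> (\<exists>c'. hstep0 Rc \<mu> W e (P - {e}) \<sigma> d c') \<rbrakk> \<Longrightarrow> hstep Rc \<mu> W (Conf P \<sigma> d) Bot"

definition terminates :: "('a \<Rightarrow> 'a \<Rightarrow> bool) \<Rightarrow> 'a \<Rightarrow> bool" where
  "terminates r c \<longleftrightarrow> \<not> (\<exists>f. f 0 = c \<and> (\<forall>i. r (f i) (f (Suc i))))"

definition final :: "('a \<Rightarrow> 'a \<Rightarrow> bool) \<Rightarrow> 'a \<Rightarrow> bool" where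
  "final r c \<longleftrightarrow> \<not> (\<exists>c'. r c c')"

end

theory Submission
  imports Defs
begin

text \<open>
  Fix the degree \<open>d\<close> of the given unifier \<open>\<tau>\<close>. Similarity to degree at least \<open>d\<close> is an
  equivalence relation on terms that preserves the shape of terms and their bound variables and is
  compatible with substitution. Along every run of the algorithm there is a substitution \<open>\<psi>\<close>
  that unifies the remaining problem to degree \<open>d\<close> and for which \<open>\<sigma>\<psi>\<close> agrees with \<open>\<tau>\<close> up to
  degree \<open>d\<close>: each binding \<open>\<theta>\<close> factors \<open>\<psi>\<close> up to similarity as \<open>\<theta>\<psi>'\<close>, where \<open>\<psi>'\<close> sends the
  fresh variables to the appropriate pieces of \<open>\<psi>\<close>. Such a \<open>\<psi>\<close> excludes every failure case (the
  occurs check by comparing sizes), and since similar terms have equal size, the total size of the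
  left-hand sides instantiated by \<open>\<psi>\<close> decreases, which gives termination without counting
  variables. The same argument applies to VarElim.
\<close>

section \<open>Renaming and substitution of patterns\<close>

text \<open>The threshold is the degree of \<open>\<tau>\<close> rather than the cut value. Only Dec
  lowers the computed degree, by the similarity of two rigid heads; these are also the heads of
  instances similar at the threshold, so the computed degree never falls below it. The threshold is
  at least the cut value, so the comparison with \<open>\<tau>\<close> at the cut follows.

  Exact agreement with \<open>\<tau>\<close> cannot be maintained: VarElim builds a binding from the
  head written in the equation, where \<open>\<psi>\<close> may have a different, similar constant.
  Agreement is demanded only on the variables in scope, because \<open>\<psi>\<close> has to be
  redefined at fresh variables.

  Patterns enter through one fact: applying a variable to distinct bound variables renames its body
  injectively. Abstraction over those variables inverts the renaming, so the term that a fresh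
  variable must stand for can be read off an instance, and no instance is larger or smaller than the
  body it comes from.\<close>

abbreviation rn :: "(nat \<Rightarrow> nat) \<Rightarrow> trm \<Rightarrow> trm" where
  "rn f \<equiv> ren f 0"

definition up :: "(nat \<Rightarrow> nat) \<Rightarrow> nat \<Rightarrow> nat" where
  "up f i = (case i of 0 \<Rightarrow> 0 | Suc j \<Rightarrow> Suc (f j))"

lemma up_simps [simp]: "up f 0 = 0" "up f (Suc i) = Suc (f i)"
  by (simp_all add: up_def)

text \<open>Trades the depth counter of \<open>ren\<close> for a modified renaming, so that later
  inductions stay at depth 0 and generalise over the renaming instead.\<close>

lemma ren_Suc: "ren f (Suc d) t = ren (up f) d t"
proof (induction t arbitrary: d)
  case (Ap h ts)
  have "renh f (Suc d) h = renh (up f) d h"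
  proof (cases h)
    case (BV i T)
    consider "i \<le> d" | j where "i = Suc (d + j)" by (metis less_iff_Suc_add not_less)
    then show ?thesis using BV by cases (auto simp: le_less)
  qed auto
  with Ap show ?case by simp
qed simp

lemma rn_Lam [simp]: "rn f (Lam T t) = Lam T (rn (up f) t)"
  by (simp add: ren_Suc)

declare ren.simps(1) [simp del]

lemma up_pow: "(up ^^ k) f i = (if i < k then i else f (i - k) + k)"
proof (induction k arbitrary: i)
  case (Suc k)
  show ?case by (cases i) (auto simp: Suc)
qed simp

lemma mk_abs_simps [simp]: "mk_abs [] u = u" "mk_abs (T # Ts) u = Lam T (mk_abs Ts u)"
  by (simp_all add: mk_abs_def)

lemma mk_abs_append: "mk_abs (Ts @ Us) u = mk_abs Ts (mk_abs Us u)"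
  by (induction Ts) auto

lemma rn_mk_abs: "rn f (mk_abs Ts u) = mk_abs Ts (rn ((up ^^ length Ts) f) u)"
  by (induction Ts arbitrary: f) (auto simp: funpow_swap1)

lemma sapp_mk_abs [simp]: "sapp \<sigma> (mk_abs Ts u) = mk_abs Ts (sapp \<sigma> u)"
  by (induction Ts) auto

lemma fv_mk_abs [simp]: "fv (mk_abs Ts u) = fv u"
  by (induction Ts) auto

lemma strip_mk_abs [simp]: "strip (length Ts) (mk_abs Ts u) = u"
  by (induction Ts) auto

fun bvh :: "hd \<Rightarrow> nat set" where
  "bvh (BV i T) = {i}"
| "bvh (C c) = {}"
| "bvh (FV X) = {}"

text \<open>Loose indices as seen from outside the term; crossing a binder discards index 0 and
  shifts the others down.\<close>

fun bv :: "trm \<Rightarrow> nat set" where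
  "bv (Lam T t) = {i. Suc i \<in> bv t}"
| "bv (Ap h ts) = bvh h \<union> \<Union> (set (map bv ts))"

lemma bv_mk_abs: "bv (mk_abs Ts u) = {i. i + length Ts \<in> bv u}"
  by (induction Ts) auto

lemma rn_cong: "(\<And>i. i \<in> bv t \<Longrightarrow> f i = g i) \<Longrightarrow> rn f t = rn g t"
proof (induction t arbitrary: f g)
  case (Lam T t)
  have "up f i = up g i" if "i \<in> bv t" for i
    using that Lam.prems by (cases i) auto
  then have "rn (up f) t = rn (up g) t" by (rule Lam.IH)
  then show ?case by simp
next
  case (Ap h ts)
  have "renh f 0 h = renh g 0 h" using Ap.prems by (cases h) auto
  moreover have "rn f t = rn g t" if "t \<in> set ts" for t
    by (rule Ap.IH[OF that]) (use Ap.prems that in auto)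
  ultimately show ?case by simp
qed

lemma up_comp: "up f \<circ> up g = up (f \<circ> g)"
  by (rule ext) (auto simp: up_def split: nat.splits)

lemma rn_rn: "rn f (rn g t) = rn (f \<circ> g) t"
proof (induction t arbitrary: f g)
  case (Ap h ts)
  then show ?case by (cases h) auto
qed (simp add: up_comp)

lemma up_id: "up (\<lambda>i. i) = (\<lambda>i. i)"
  by (rule ext) (auto simp: up_def split: nat.splits)

lemma rn_id: "rn (\<lambda>i. i) t = t"
proof (induction t)
  case (Ap h ts)
  then show ?case by (cases h) (auto intro: map_idI)
qed (simp add: up_id)

lemma rn_id_on: "(\<And>i. i \<in> bv t \<Longrightarrow> f i = i) \<Longrightarrow> rn f t = t"
  using rn_cong[of t f "\<lambda>i. i"] rn_id by simp

lemma bv_rn: "bv (rn f t) = f ` bv t"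
proof (induction t arbitrary: f)
  case (Lam T t)
  have "Suc i \<in> up f ` bv t \<longleftrightarrow> i \<in> f ` {i. Suc i \<in> bv t}" for i
  proof
    assume "Suc i \<in> up f ` bv t"
    then obtain k where "k \<in> bv t" "Suc i = up f k" by auto
    then show "i \<in> f ` {i. Suc i \<in> bv t}" by (cases k) auto
  qed (metis (mono_tags, lifting) image_iff mem_Collect_eq up_simps(2))
  then show ?case using Lam by simp
next
  case (Ap h ts)
  then show ?case by (cases h) auto
qed

lemma fv_rn [simp]: "fv (rn f t) = fv t"
proof (induction t arbitrary: f)
  case (Ap h ts)
  then show ?case by (cases h) auto
qed simp

text \<open>Arguments of a free variable are determined by their indices, because the context
  supplies the annotations; conditions on argument lists become conditions on lists of
  naturals.\<close>

definition bva :: "ty list \<Rightarrow> nat list \<Rightarrow> trm list" where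
  "bva \<Gamma> is = map (\<lambda>i. Ap (BV i (\<Gamma> ! i)) []) is"

fun rigid_in :: "ty list \<Rightarrow> hd \<Rightarrow> bool" where
  "rigid_in \<Gamma> (C c) = True"
| "rigid_in \<Gamma> (BV i S) = (i < length \<Gamma> \<and> \<Gamma> ! i = S)"
| "rigid_in \<Gamma> (FV X) = False"

lemma length_bva [simp]: "length (bva \<Gamma> is) = length is"
  by (simp add: bva_def)

lemma nth_bva [simp]: "i < length is \<Longrightarrow> bva \<Gamma> is ! i = Ap (BV (is ! i) (\<Gamma> ! (is ! i))) []"
  by (simp add: bva_def)

lemma bva_bvatom [simp]: "\<forall>x \<in> set (bva \<Gamma> is). is_bvatom x"
  by (auto simp: bva_def)

lemma map_bidx_bva [simp]: "map bidx (bva \<Gamma> is) = is"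
  by (simp add: bva_def map_idI)

lemma map_typeof_bva [simp]: "map typeof (bva \<Gamma> is) = map ((!) \<Gamma>) is"
  by (simp add: bva_def)

lemma mem_bva: "Ap (BV i S) [] \<in> set (bva \<Gamma> is) \<longleftrightarrow> i \<in> set is \<and> S = \<Gamma> ! i"
  by (auto simp: bva_def)

lemma bv_bva [simp]: "bv (Ap (FV X) (bva \<Gamma> is)) = set is"
  by (auto simp: bva_def)

lemma fv_bva [simp]: "fv (Ap (FV X) (bva \<Gamma> is)) = {X}"
  by (auto simp: bva_def)

section \<open>Introduction, induction and inversion for patterns\<close>

lemma hopat_flexI:
  assumes "distinct is" "set is \<subseteq> {..<length \<Gamma>}" "snd X = arrows (map ((!) \<Gamma>) is) (Base b)"
  shows "hopat \<Gamma> (Ap (FV X) (bva \<Gamma> is)) (Base b)"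
proof -
  let ?js = "map (\<lambda>i. (i, \<Gamma> ! i)) is"
  have "hopat \<Gamma> (Ap (FV X) (map (\<lambda>(j, S). Ap (BV j S) []) ?js)) (Base b)"
    using assms by (intro pat_free) (auto simp: o_def)
  then show ?thesis by (simp add: bva_def o_def)
qed

lemma hopat_rigidI:
  assumes "rigid_in \<Gamma> h" "headty h = arrows Ts (Base b)" "length ts = length Ts"
    "\<forall>i<length ts. hopat \<Gamma> (ts ! i) (Ts ! i)"
  shows "hopat \<Gamma> (Ap h ts) (Base b)"
  using assms by (cases h) (auto intro: pat_const pat_bound)

text \<open>Constants and bound variables behave alike under substitution, so later inductions only
  separate rigid from flexible heads.\<close>

lemma hopat_pattern_induct [consumes 1, case_names Lam Rigid Flex]:
  assumes "hopat \<Gamma> t T"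
    and L: "\<And>T \<Gamma> t U. hopat (T # \<Gamma>) t U \<Longrightarrow> P (T # \<Gamma>) t U \<Longrightarrow> P \<Gamma> (Lam T t) (Fun T U)"
    and R: "\<And>\<Gamma> h ts Ts b. rigid_in \<Gamma> h \<Longrightarrow> headty h = arrows Ts (Base b) \<Longrightarrow> length ts = length Ts \<Longrightarrow>
       (\<And>i. i < length ts \<Longrightarrow> hopat \<Gamma> (ts ! i) (Ts ! i)) \<Longrightarrow>
       (\<And>i. i < length ts \<Longrightarrow> P \<Gamma> (ts ! i) (Ts ! i)) \<Longrightarrow> P \<Gamma> (Ap h ts) (Base b)"
    and F: "\<And>\<Gamma> is X b. distinct is \<Longrightarrow> set is \<subseteq> {..<length \<Gamma>} \<Longrightarrow>
       snd X = arrows (map ((!) \<Gamma>) is) (Base b) \<Longrightarrow> P \<Gamma> (Ap (FV X) (bva \<Gamma> is)) (Base b)"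
  shows "P \<Gamma> t T"
  using assms(1)
proof induction
  case (pat_lam T \<Gamma> t U)
  then show ?case by (rule L)
next
  case (pat_const ts Ts \<Gamma> c b)
  then show ?case by (intro R[where Ts = Ts]) auto
next
  case (pat_bound i \<Gamma> S Ts b ts)
  then show ?case by (intro R[where Ts = Ts]) auto
next
  case (pat_free js \<Gamma> X b)
  have 1: "map ((!) \<Gamma>) (map fst js) = map snd js" using pat_free(2) by auto
  have 2: "map (\<lambda>(j, S). Ap (BV j S) []) js = bva \<Gamma> (map fst js)"
    using pat_free(2) by (auto simp: bva_def)
  show ?case unfolding 2
  proof (rule F)
    show "snd X = arrows (map ((!) \<Gamma>) (map fst js)) (Base b)" by (simp only: 1 pat_free(3))
  qed (use pat_free in auto)
qed

lemma hopat_flexE: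
  assumes "hopat \<Gamma> (Ap (FV X) ts) T"
  obtains "is" b where "ts = bva \<Gamma> is" "distinct is" "set is \<subseteq> {..<length \<Gamma>}"
    "snd X = arrows (map ((!) \<Gamma>) is) (Base b)" "T = Base b"
  using assms
proof cases
  case (pat_free js b)
  have 1: "map ((!) \<Gamma>) (map fst js) = map snd js" using pat_free by auto
  have 2: "map (\<lambda>(j, S). Ap (BV j S) []) js = bva \<Gamma> (map fst js)"
    using pat_free by (auto simp: bva_def)
  show ?thesis
  proof (rule that[of "map fst js" b])
    show "snd X = arrows (map ((!) \<Gamma>) (map fst js)) (Base b)" using pat_free by (simp only: 1)
  qed (use pat_free 2 in auto)
qed

lemma hopat_rigidE:
  assumes "hopat \<Gamma> (Ap h ts) T" "\<And>X. h \<noteq> FV X"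
  obtains Ts b where "rigid_in \<Gamma> h" "headty h = arrows Ts (Base b)" "length ts = length Ts"
    "\<forall>i<length ts. hopat \<Gamma> (ts ! i) (Ts ! i)" "T = Base b"
  using assms by cases auto

lemma hopat_LamE:
  assumes "hopat \<Gamma> (Lam S t) T"
  obtains U where "T = Fun S U" "hopat (S # \<Gamma>) t U"
  using assms by cases auto

lemma hopat_FunE:
  assumes "hopat \<Gamma> t (Fun S U)"
  obtains u where "t = Lam S u" "hopat (S # \<Gamma>) u U"
  using assms by cases auto

lemma hopat_BaseE:
  assumes "hopat \<Gamma> t (Base b)"
  obtains h ts where "t = Ap h ts"
  using assms by cases auto

lemma argtys_arrows [simp]: "argtys (arrows Ts U) = Ts @ argtys U"
  by (induction Ts) auto

lemma resty_arrows [simp]: "resty (arrows Ts U) = resty U"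
  by (induction Ts) auto

lemma arrows_argtys [simp]: "arrows (argtys T) (resty T) = T"
  by (induction T) auto

lemma arrows_append: "arrows (Ts @ Us) U = arrows Ts (arrows Us U)"
  by (induction Ts) auto

lemma resty_Base: obtains b where "resty T = Base b"
  by (induction T) auto

text \<open>Eta-long form makes the number of leading binders a function of the type, so
  \<open>strip\<close> with that number exposes the whole body.\<close>

lemma hopat_eta_long:
  assumes "hopat \<Gamma> t T"
  obtains u where "t = mk_abs (argtys T) u" "hopat (rev (argtys T) @ \<Gamma>) u (resty T)"
proof -
  have "\<exists>u. t = mk_abs (argtys T) u \<and> hopat (rev (argtys T) @ \<Gamma>) u (resty T)"
  using assms proof (induction T arbitrary: \<Gamma> t rule: ty.induct)
    case (Fun S U)
    from Fun.prems obtain u where "t = Lam S u" "hopat (S # \<Gamma>) u U" by (rule hopat_FunE)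
    with Fun.IH(2)[OF this(2)] show ?case by auto
  qed simp
  with that show ?thesis by blast
qed

lemma hopat_mk_abs:
  "hopat (rev Ts @ \<Gamma>) u U \<Longrightarrow> hopat \<Gamma> (mk_abs Ts u) (arrows Ts U)"
  by (induction Ts arbitrary: \<Gamma>) (auto intro: pat_lam)

lemma hopat_bv: "hopat \<Gamma> t T \<Longrightarrow> bv t \<subseteq> {..<length \<Gamma>}"
proof (induction rule: hopat_pattern_induct)
  case (Rigid \<Gamma> h ts Ts b)
  then have "bvh h \<subseteq> {..<length \<Gamma>}" by (cases h) auto
  with Rigid show ?case by (auto simp: set_conv_nth) blast
next
  case (Flex \<Gamma> "is" X b)
  then show ?case by (auto simp: bva_def)
qed auto

text \<open>Injectivity on the loose indices keeps the arguments of free variables pairwise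
  distinct, hence the result a pattern.\<close>

lemma hopat_rn:
  assumes "hopat \<Gamma> t T" "\<And>i. i \<in> bv t \<Longrightarrow> f i < length \<Delta> \<and> \<Delta> ! f i = \<Gamma> ! i" "inj_on f (bv t)"
  shows "hopat \<Delta> (rn f t) T"
  using assms
proof (induction arbitrary: f \<Delta> rule: hopat_pattern_induct)
  case (Lam T \<Gamma> t U)
  have "hopat (T # \<Delta>) (rn (up f) t) U"
  proof (rule Lam.IH)
    fix i assume "i \<in> bv t"
    then show "up f i < length (T # \<Delta>) \<and> (T # \<Delta>) ! up f i = (T # \<Gamma>) ! i"
      using Lam.prems(1) by (cases i) auto
  next
    show "inj_on (up f) (bv t)"
      using Lam.prems(2) by (auto simp: inj_on_def up_def split: nat.splits)
  qed
  then show ?case by (auto intro: pat_lam)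
next
  case (Rigid \<Gamma> h ts Ts b)
  have "rigid_in \<Delta> (renh f 0 h)" "headty (renh f 0 h) = headty h"
    using Rigid.hyps(1) Rigid.prems(1) by (cases h; auto)+
  moreover have "hopat \<Delta> (rn f (ts ! i)) (Ts ! i)" if "i < length ts" for i
  proof (rule Rigid.IH[OF that])
    have sub: "bv (ts ! i) \<subseteq> bv (Ap h ts)" using that by auto
    then show "inj_on f (bv (ts ! i))" using Rigid.prems(2) inj_on_subset by blast
    show "f j < length \<Delta> \<and> \<Delta> ! f j = \<Gamma> ! j" if "j \<in> bv (ts ! i)" for j
      using Rigid.prems(1) sub that by blast
  qed
  ultimately show ?case using Rigid.hyps by (auto intro!: hopat_rigidI)
next
  case (Flex \<Gamma> "is" X b)
  have *: "\<And>i. i \<in> set is \<Longrightarrow> f i < length \<Delta> \<and> \<Delta> ! f i = \<Gamma> ! i" using Flex(4) by (simp del: bv.simps)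
  have "rn f (Ap (FV X) (bva \<Gamma> is)) = Ap (FV X) (bva \<Delta> (map f is))"
    using * by (auto simp: bva_def)
  moreover have "hopat \<Delta> (Ap (FV X) (bva \<Delta> (map f is))) (Base b)"
    using Flex(1,3) Flex(5)[unfolded bv_bva] *
    by (intro hopat_flexI) (auto simp: distinct_map o_def cong: map_cong)
  ultimately show ?case by simp
qed

text \<open>
  \<open>look is\<close> is the renaming performed by beta reduction when a term with body \<open>u\<close> is applied to the
  bound variables \<open>is\<close>; \<open>unlook is\<close> is the one performed by \<^const>\<open>abstr\<close>. The innermost binder has
  index 0, so argument lists are read backwards.
\<close>

definition look :: "nat list \<Rightarrow> nat \<Rightarrow> nat" where
  "look is i = (if i < length is then is ! (length is - 1 - i) else i - length is)"

definition unlook :: "nat list \<Rightarrow> nat \<Rightarrow> nat" where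
  "unlook is i = length is - 1 - pos is i"

lemma pos_nth: "distinct xs \<Longrightarrow> i < length xs \<Longrightarrow> pos xs (xs ! i) = i"
  by (induction xs arbitrary: i) (auto simp: nth_Cons split: nat.splits)

lemma pos_less: "x \<in> set xs \<Longrightarrow> pos xs x < length xs \<and> xs ! pos xs x = x"
  by (induction xs) auto

lemma unlook_look: "distinct is \<Longrightarrow> i < length is \<Longrightarrow> unlook is (look is i) = i"
  by (simp add: unlook_def look_def pos_nth)

lemma look_unlook: "i \<in> set is \<Longrightarrow> look is (unlook is i) = i"
  using pos_less[of i "is"] by (auto simp: unlook_def look_def)

lemma look_mem: "i < length is \<Longrightarrow> look is i \<in> set is"
  by (simp add: look_def)

lemma unlook_less: "i \<in> set is \<Longrightarrow> unlook is i < length is"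
  using pos_less[of i "is"] by (auto simp: unlook_def)

lemma inj_on_look: "distinct is \<Longrightarrow> inj_on (look is) {..<length is}"
  by (metis inj_on_inverseI lessThan_iff unlook_look)

lemma inj_on_unlook: "inj_on (unlook is) (set is)"
  by (metis inj_on_inverseI look_unlook)

section \<open>Action of substitutions on patterns\<close>

lemma sapp_rigid [simp]: "(\<And>X. h \<noteq> FV X) \<Longrightarrow> sapp \<sigma> (Ap h ts) = Ap h (map (sapp \<sigma>) ts)"
  by (cases h) auto

lemma rigid_in_noFV: "rigid_in \<Gamma> h \<Longrightarrow> h \<noteq> FV X"
  by auto

lemma sapp_flex_args:
  assumes "\<forall>t\<in>set ts. is_bvatom t" "map bidx ts = is"
  shows "sapp \<sigma> (Ap (FV X) ts) = rn (look is) (strip (length is) (\<sigma> X))"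
proof -
  have l: "length is = length ts" using assms(2) by auto
  have "(\<lambda>i. if i < length ts then bidx (ts ! (length ts - 1 - i)) else i - length ts) = look is"
    by (rule ext) (auto simp: look_def l simp flip: assms(2))
  then show ?thesis using assms(1) l by (simp add: l del: One_nat_def)
qed

lemma sapp_flex: "sapp \<sigma> (Ap (FV X) (bva \<Gamma> is)) = rn (look is) (strip (length is) (\<sigma> X))"
  by (rule sapp_flex_args) simp_all

declare sapp.simps(2) [simp del]

text \<open>The local half of \<open>is_subst\<close>: the algebra of substitution rests on
  well-typed pattern bindings, while finiteness of the domain matters only for choosing fresh
  variables.\<close>

definition wsub :: "subst \<Rightarrow> bool" where
  "wsub \<sigma> \<longleftrightarrow> (\<forall>X. hopat [] (\<sigma> X) (snd X))"

lemma wsubD: "wsub \<sigma> \<Longrightarrow> hopat [] (\<sigma> X) (snd X)"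
  by (simp add: wsub_def del: split_paired_All)

text \<open>The context \<open>\<Delta>\<close> is arbitrary because beta reduction reads the
  indices of the arguments and not their annotations.\<close>

lemma wsub_flex:
  assumes "wsub \<sigma>" "snd X = arrows (map ((!) \<Gamma>) is) (Base b)"
  obtains u where "\<sigma> X = mk_abs (map ((!) \<Gamma>) is) u" "hopat (rev (map ((!) \<Gamma>) is)) u (Base b)"
    "\<forall>\<Delta>. sapp \<sigma> (Ap (FV X) (bva \<Delta> is)) = rn (look is) u" "bv u \<subseteq> {..<length is}"
proof -
  have "hopat [] (\<sigma> X) (snd X)" by (rule wsubD[OF assms(1)])
  then obtain u where u: "\<sigma> X = mk_abs (argtys (snd X)) u"
    "hopat (rev (argtys (snd X)) @ []) u (resty (snd X))" by (rule hopat_eta_long)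
  have s: "strip (length is) (\<sigma> X) = u"
    using u(1) assms(2) strip_mk_abs[of "map ((!) \<Gamma>) is" u] by simp
  show ?thesis
    by (rule that[of u]) (use u assms(2) hopat_bv[OF u(2)] s in \<open>auto simp: sapp_flex\<close>)
qed

text \<open>In the flexible case the binders of the body are replaced by distinct variables, which
  is an injective renaming, so \<open>hopat_rn\<close> applies.\<close>

lemma hopat_sapp:
  assumes "hopat \<Gamma> t T" "wsub \<sigma>"
  shows "hopat \<Gamma> (sapp \<sigma> t) T"
  using assms(1)
proof (induction rule: hopat_pattern_induct)
  case (Rigid \<Gamma> h ts Ts b)
  then show ?case by (auto simp: rigid_in_noFV intro!: hopat_rigidI)
next
  case (Flex \<Gamma> "is" X b)
  obtain u where u: "\<sigma> X = mk_abs (map ((!) \<Gamma>) is) u" "hopat (rev (map ((!) \<Gamma>) is)) u (Base b)"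
    "\<forall>\<Delta>. sapp \<sigma> (Ap (FV X) (bva \<Delta> is)) = rn (look is) u" "bv u \<subseteq> {..<length is}"
    by (rule wsub_flex[OF assms(2) Flex(3)])
  have "hopat \<Gamma> (rn (look is) u) (Base b)"
  proof (rule hopat_rn[OF u(2)])
    fix i assume "i \<in> bv u"
    then have "i < length is" using u by auto
    moreover from this have "look is i < length \<Gamma>" using look_mem Flex(2) by blast
    ultimately show "look is i < length \<Gamma> \<and> \<Gamma> ! look is i = rev (map ((!) \<Gamma>) is) ! i"
      by (auto simp: look_def rev_nth)
  next
    show "inj_on (look is) (bv u)" using inj_on_look[OF Flex(1)] u(4) inj_on_subset by blast
  qed
  then show ?case using u by simp
qed (auto intro: pat_lam)

lemma bv_sapp_flex:
  assumes "wsub \<sigma>" "snd X = arrows (map ((!) \<Gamma>) is) (Base b)"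
  shows "bv (sapp \<sigma> (Ap (FV X) (bva \<Delta> is))) \<subseteq> set is"
proof -
  obtain u where u: "\<sigma> X = mk_abs (map ((!) \<Gamma>) is) u" "hopat (rev (map ((!) \<Gamma>) is)) u (Base b)"
    "\<forall>\<Delta>. sapp \<sigma> (Ap (FV X) (bva \<Delta> is)) = rn (look is) u" "bv u \<subseteq> {..<length is}"
    by (rule wsub_flex[OF assms])
  then show ?thesis by (auto simp: bv_rn intro!: look_mem)
qed

lemma sapp_rn:
  assumes "hopat \<Gamma> t T" "wsub \<sigma>"
  shows "sapp \<sigma> (rn f t) = rn f (sapp \<sigma> t)"
  using assms(1)
proof (induction arbitrary: f rule: hopat_pattern_induct)
  case (Rigid \<Gamma> h ts Ts b)
  then have "\<And>X. renh f 0 h \<noteq> FV X" by (cases h) auto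
  with Rigid show ?case by (auto simp: rigid_in_noFV set_conv_nth)
next
  case (Flex \<Gamma> "is" X b)
  obtain u where u: "\<sigma> X = mk_abs (map ((!) \<Gamma>) is) u" "hopat (rev (map ((!) \<Gamma>) is)) u (Base b)"
    "\<forall>\<Delta>. sapp \<sigma> (Ap (FV X) (bva \<Delta> is)) = rn (look is) u" "bv u \<subseteq> {..<length is}"
    by (rule wsub_flex[OF assms(2) Flex(3)])
  have s: "strip (length is) (\<sigma> X) = u"
    using u(1) strip_mk_abs[of "map ((!) \<Gamma>) is" u] by simp
  have "sapp \<sigma> (Ap (FV X) (map (rn f) (bva \<Gamma> is))) =
      rn (look (map f is)) (strip (length (map f is)) (\<sigma> X))"
    by (rule sapp_flex_args) (auto simp: bva_def)
  also have "\<dots> = rn (look (map f is)) u" using s by simp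
  \<comment> \<open>The two renamings can differ only at indices not below \<open>length is\<close>,
    and \<open>u\<close> has no such loose index.\<close>
  also have "\<dots> = rn (f \<circ> look is) u"
    by (rule rn_cong) (use u in \<open>auto simp: look_def\<close>)
  finally show ?case using u by (simp add: rn_rn)
qed auto

lemma sapp_comp:
  assumes "hopat \<Gamma> t T" "wsub \<theta>" "wsub \<psi>"
  shows "sapp \<psi> (sapp \<theta> t) = sapp (comp \<theta> \<psi>) t"
  using assms(1)
proof (induction rule: hopat_pattern_induct)
  case (Rigid \<Gamma> h ts Ts b)
  then show ?case by (auto simp: rigid_in_noFV set_conv_nth)
next
  case (Flex \<Gamma> "is" X b)
  obtain u where u: "\<theta> X = mk_abs (map ((!) \<Gamma>) is) u" "hopat (rev (map ((!) \<Gamma>) is)) u (Base b)"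
    "\<forall>\<Delta>. sapp \<theta> (Ap (FV X) (bva \<Delta> is)) = rn (look is) u" "bv u \<subseteq> {..<length is}"
    by (rule wsub_flex[OF assms(2) Flex(3)])
  have "strip (length is) (comp \<theta> \<psi> X) = sapp \<psi> u"
    using u(1) strip_mk_abs[of "map ((!) \<Gamma>) is" "sapp \<psi> u"] by (simp add: comp_def)
  then show ?case using u by (simp add: sapp_flex sapp_rn[OF u(2) assms(3)])
qed auto

lemma wsub_comp: "wsub \<sigma> \<Longrightarrow> wsub \<theta> \<Longrightarrow> wsub (comp \<sigma> \<theta>)"
  by (simp add: wsub_def comp_def hopat_sapp del: split_paired_All)

lemma sapp_cong:
  assumes "hopat \<Gamma> t T" "\<And>X. X \<in> fv t \<Longrightarrow> \<sigma> X = \<theta> X"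
  shows "sapp \<sigma> t = sapp \<theta> t"
  using assms
proof (induction rule: hopat_pattern_induct)
  case (Rigid \<Gamma> h ts Ts b)
  have "sapp \<sigma> (ts ! i) = sapp \<theta> (ts ! i)" if "i < length ts" for i
    by (rule Rigid.IH[OF that]) (use Rigid.prems that in \<open>simp, blast intro: nth_mem\<close>)
  then have "map (sapp \<sigma>) ts = map (sapp \<theta>) ts" by (intro nth_equalityI) auto
  with Rigid.hyps show ?case by (simp add: rigid_in_noFV)
next
  case (Flex \<Gamma> "is" X b)
  then show ?case by (simp add: sapp_flex)
qed auto

lemma fv_sapp:
  assumes "hopat \<Gamma> t T" "wsub \<sigma>"
  shows "fv (sapp \<sigma> t) \<subseteq> (\<Union>X\<in>fv t. fv (\<sigma> X))"
  using assms(1)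
proof (induction rule: hopat_pattern_induct)
  case (Rigid \<Gamma> h ts Ts b)
  then have h: "fvh h = {}" "\<And>X. h \<noteq> FV X" by (cases h; auto)+
  have "fv (sapp \<sigma> s) \<subseteq> (\<Union>X\<in>fv s. fv (\<sigma> X))" if "s \<in> set ts" for s
    using that Rigid by (auto simp: in_set_conv_nth)
  then show ?case using h by (simp add: UN_subset_iff) blast
next
  case (Flex \<Gamma> "is" X b)
  obtain u where u: "\<sigma> X = mk_abs (map ((!) \<Gamma>) is) u" "hopat (rev (map ((!) \<Gamma>) is)) u (Base b)"
    "\<forall>\<Delta>. sapp \<sigma> (Ap (FV X) (bva \<Delta> is)) = rn (look is) u" "bv u \<subseteq> {..<length is}"
    by (rule wsub_flex[OF assms(2) Flex(3)])
  then show ?case by (auto simp del: fv.simps)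
qed auto

lemma canon_bva: "canon Ts = bva (rev Ts @ \<Gamma>) (rev [0..<length Ts])"
  by (rule nth_equalityI) (auto simp: canon_def rev_nth nth_append)

lemma look_canon: "i < n \<Longrightarrow> look (rev [0..<n]) i = i"
  by (simp add: look_def rev_nth)

lemma hopat_eta_var: "hopat \<Gamma> (eta_var X) (snd X)"
proof -
  let ?Ts = "argtys (snd X)"
  obtain b where b: "resty (snd X) = Base b" by (rule resty_Base)
  have m: "map ((!) (rev ?Ts @ \<Gamma>)) (rev [0..<length ?Ts]) = ?Ts"
    by (rule nth_equalityI) (auto simp: rev_nth nth_append)
  have "hopat (rev ?Ts @ \<Gamma>) (Ap (FV X) (canon ?Ts)) (Base b)"
    unfolding canon_bva[of _ \<Gamma>] using b
    by (intro hopat_flexI) (simp_all only: m, auto, metis arrows_argtys)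
  from hopat_mk_abs[OF this] b show ?thesis by (metis arrows_argtys eta_var_def)
qed

lemma fv_eta_var [simp]: "fv (eta_var X) = {X}"
  by (simp add: eta_var_def canon_bva[of _ "[]"] del: fv.simps)

lemma sapp_eta_var:
  assumes "wsub \<sigma>"
  shows "sapp \<sigma> (eta_var X) = \<sigma> X"
proof -
  let ?Ts = "argtys (snd X)"
  have "hopat [] (\<sigma> X) (snd X)" by (rule wsubD[OF assms(1)])
  then obtain u where u: "\<sigma> X = mk_abs ?Ts u" "hopat (rev ?Ts @ []) u (resty (snd X))"
    by (rule hopat_eta_long)
  have "sapp \<sigma> (Ap (FV X) (canon ?Ts)) = rn (look (rev [0..<length ?Ts])) u"
    unfolding canon_bva[of _ "[]"] sapp_flex using u(1) by simp
  also have "\<dots> = u" using hopat_bv[OF u(2)] by (intro rn_id_on look_canon) auto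
  finally show ?thesis using u(1) by (simp add: eta_var_def)
qed

lemma sapp_eta:
  assumes "hopat \<Gamma> t T" "\<And>X. X \<in> fv t \<Longrightarrow> \<theta> X = eta_var X"
  shows "sapp \<theta> t = t"
proof -
  have "sapp eta_var t = t"
  using assms(1) proof (induction rule: hopat_pattern_induct)
    case (Rigid \<Gamma> h ts Ts b)
    then have "map (sapp eta_var) ts = ts" by (auto intro: nth_equalityI)
    with Rigid show ?case by (simp add: rigid_in_noFV)
  next
    case (Flex \<Gamma> "is" X b)
    have w: "wsub eta_var" by (simp add: wsub_def hopat_eta_var del: split_paired_All)
    have l: "length is = length (argtys (snd X))" using Flex by simp
    have "sapp eta_var (Ap (FV X) (bva \<Gamma> is)) =
      rn (look is) (Ap (FV X) (bva (rev (argtys (snd X)) @ []) (rev [0..<length is])))"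
      unfolding sapp_flex eta_var_def l strip_mk_abs canon_bva[of _ "[]"] by simp
    \<comment> \<open>The annotations come from the type of \<open>X\<close>; they agree with the
      context because the argument types of \<open>X\<close> are the types of \<open>is\<close>
      there.\<close>
    also have "\<dots> = Ap (FV X) (bva \<Gamma> is)"
      using Flex(3) by (auto simp: bva_def look_def rev_nth nth_append intro!: nth_equalityI)
    finally show ?case .
  qed simp
  then show ?thesis using sapp_cong[OF assms] by simp
qed

section \<open>Abstraction over bound variables as inverse of application\<close>

lemma abstr_bva [simp]: "abstr Ts (bva \<Gamma> is) u = mk_abs Ts (rn (unlook is) u)"
  by (simp add: abstr_def unlook_def[abs_def])

text \<open>The condition on \<open>bv u\<close> is the variable condition of pattern unification: a
  loose index outside \<open>is\<close> would escape, and the binding would not be closed.\<close>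

lemma hopat_abstr:
  assumes "hopat \<Gamma> u U" "bv u \<subseteq> set is"
  shows "hopat [] (mk_abs (map ((!) \<Gamma>) is) (rn (unlook is) u)) (arrows (map ((!) \<Gamma>) is) U)"
proof (rule hopat_mk_abs, rule hopat_rn[OF assms(1)])
  fix i assume "i \<in> bv u"
  then have i: "i \<in> set is" using assms by auto
  show "unlook is i < length (rev (map ((!) \<Gamma>) is) @ []) \<and> (rev (map ((!) \<Gamma>) is) @ []) ! unlook is i = \<Gamma> ! i"
    using unlook_less[OF i] pos_less[OF i] by (auto simp: rev_nth unlook_def)
next
  show "inj_on (unlook is) (bv u)" using inj_on_unlook assms(2) inj_on_subset by blast
qed

text \<open>Abstraction followed by application needs only that \<open>is\<close> covers the loose
  indices. The opposite order, in \<open>abstr_sapp_inst\<close>, needs \<open>is\<close> distinct;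
  it expresses that a binding is determined by one instance.\<close>

lemma sapp_abstr_inst:
  assumes "\<sigma> H = mk_abs (map ((!) \<Gamma>) is) (rn (unlook is) u)" "bv u \<subseteq> set is"
  shows "sapp \<sigma> (Ap (FV H) (bva \<Gamma> is)) = u"
proof -
  have "strip (length is) (\<sigma> H) = rn (unlook is) u"
    unfolding assms(1) using strip_mk_abs[of "map ((!) \<Gamma>) is"] by simp
  then have "sapp \<sigma> (Ap (FV H) (bva \<Gamma> is)) = rn (look is \<circ> unlook is) u"
    by (simp add: sapp_flex rn_rn)
  also have "\<dots> = u" using assms(2) by (intro rn_id_on) (auto simp: look_unlook)
  finally show ?thesis .
qed

lemma abstr_sapp_inst:
  assumes "wsub \<sigma>" "snd X = arrows (map ((!) \<Gamma>) is) (Base b)" "distinct is"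
  shows "mk_abs (map ((!) \<Gamma>) is) (rn (unlook is) (sapp \<sigma> (Ap (FV X) (bva \<Delta> is)))) = \<sigma> X"
proof -
  obtain u where u: "\<sigma> X = mk_abs (map ((!) \<Gamma>) is) u" "hopat (rev (map ((!) \<Gamma>) is)) u (Base b)"
    "\<forall>\<Delta>. sapp \<sigma> (Ap (FV X) (bva \<Delta> is)) = rn (look is) u" "bv u \<subseteq> {..<length is}"
    by (rule wsub_flex[OF assms(1,2)])
  have "rn (unlook is) (rn (look is) u) = u"
    unfolding rn_rn using u(4) assms(3) by (intro rn_id_on) (auto simp: unlook_look)
  then show ?thesis using u by simp
qed

text \<open>The arguments of \<open>H\<close> in \<^const>\<open>eta_app\<close>, seen below the \<open>k\<close> binders added by eta expansion.\<close>

definition lift_args :: "nat \<Rightarrow> nat list \<Rightarrow> nat list" where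
  "lift_args k is = map (\<lambda>i. i + k) is @ rev [0..<k]"

lemma eta_app_bva:
  "eta_app H (bva \<Gamma> is) T =
     mk_abs (argtys T) (Ap (FV H) (bva (rev (argtys T) @ \<Gamma>) (lift_args (length (argtys T)) is)))"
proof -
  let ?k = "length (argtys T)"
  have "map (lift ?k) (bva \<Gamma> is) = bva (rev (argtys T) @ \<Gamma>) (map (\<lambda>i. i + ?k) is)"
    by (simp add: bva_def lift_def nth_append)
  then have "map (lift ?k) (bva \<Gamma> is) @ canon (argtys T) = bva (rev (argtys T) @ \<Gamma>) (lift_args ?k is)"
    by (simp add: lift_args_def canon_bva[of _ \<Gamma>]) (simp add: bva_def)
  then show ?thesis by (simp add: eta_app_def)
qed

lemma lift_args_types:
  "map ((!) (rev Us @ \<Gamma>)) (lift_args (length Us) is) = map ((!) \<Gamma>) is @ Us"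
  by (rule nth_equalityI) (auto simp: lift_args_def nth_append rev_nth)

lemma hopat_eta_app:
  assumes "distinct is" "set is \<subseteq> {..<length \<Gamma>}" "snd H = arrows (map ((!) \<Gamma>) is) T"
  shows "hopat \<Gamma> (eta_app H (bva \<Gamma> is) T) T"
proof -
  obtain b where b: "resty T = Base b" by (rule resty_Base)
  have T: "arrows (argtys T) (Base b) = T" using b by (metis arrows_argtys)
  have "hopat (rev (argtys T) @ \<Gamma>)
     (Ap (FV H) (bva (rev (argtys T) @ \<Gamma>) (lift_args (length (argtys T)) is))) (Base b)"
  proof (rule hopat_flexI)
    show "snd H = arrows (map ((!) (rev (argtys T) @ \<Gamma>)) (lift_args (length (argtys T)) is)) (Base b)"
      unfolding lift_args_types arrows_append using assms(3) T by simp
  qed (use assms in \<open>auto simp: lift_args_def distinct_map\<close>)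
  from hopat_mk_abs[OF this] show ?thesis unfolding eta_app_bva using T by simp
qed

lemma fv_eta_app [simp]: "fv (eta_app H (bva \<Gamma> is) T) = {H}"
  by (simp add: eta_app_bva del: fv.simps)

lemma bv_eta_app: "bv (eta_app H (bva \<Gamma> is) T) \<subseteq> set is"
  by (auto simp: eta_app_bva bv_mk_abs lift_args_def simp del: bv.simps)

lemma sapp_eta_app:
  assumes "hopat \<Gamma> u T" "bv u \<subseteq> set is" "\<sigma> H = mk_abs (map ((!) \<Gamma>) is) (rn (unlook is) u)"
  shows "sapp \<sigma> (eta_app H (bva \<Gamma> is) T) = u"
proof -
  let ?k = "length (argtys T)"
  obtain v where v: "u = mk_abs (argtys T) v" using assms(1) by (rule hopat_eta_long)
  \<comment> \<open>The leading binders of \<open>u\<close> follow those for \<open>is\<close>, so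
    \<open>H\<close> consumes both groups at once and the renaming passes under \<open>?k\<close>
    binders.\<close>
  have "\<sigma> H = mk_abs (map ((!) \<Gamma>) is @ argtys T) (rn ((up ^^ ?k) (unlook is)) v)"
    by (simp add: assms(3) v rn_mk_abs mk_abs_append)
  then have "strip (length (lift_args ?k is)) (\<sigma> H) = rn ((up ^^ ?k) (unlook is)) v"
    using strip_mk_abs[of "map ((!) \<Gamma>) is @ argtys T"] by (simp add: lift_args_def)
  then have "sapp \<sigma> (eta_app H (bva \<Gamma> is) T)
     = mk_abs (argtys T) (rn (look (lift_args ?k is)) (rn ((up ^^ ?k) (unlook is)) v))"
    by (simp add: eta_app_bva sapp_flex)
  \<comment> \<open>Indices below \<open>?k\<close> belong to the eta-expansion and stay fixed; the
    others are loose indices of \<open>u\<close> shifted by \<open>?k\<close>, which lie in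
    \<open>is\<close>.\<close>
  moreover have "look (lift_args ?k is) ((up ^^ ?k) (unlook is) i) = i" if "i \<in> bv v" for i
  proof (cases "i < ?k")
    case True
    then show ?thesis by (auto simp: up_pow look_def lift_args_def nth_append rev_nth)
  next
    case False
    then have "i - ?k \<in> bv u" using that v by (simp add: bv_mk_abs)
    then have "i - ?k \<in> set is" using assms(2) by auto
    from look_unlook[OF this] unlook_less[OF this] False show ?thesis
      by (auto simp: up_pow look_def lift_args_def nth_append rev_nth)
  qed
  ultimately show ?thesis using v by (simp add: rn_rn rn_id_on)
qed

section \<open>Terms similar up to a fixed degree\<close>

lemma is_subst_wsub: "is_subst \<sigma> \<longleftrightarrow> finite (Dom \<sigma>) \<and> wsub \<sigma>"
  unfolding is_subst_def wsub_def by (rule refl)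

lemma is_substD [dest]: "is_subst \<sigma> \<Longrightarrow> wsub \<sigma>"
  by (simp add: is_subst_wsub)

lemma is_subst_eps: "is_subst eta_var"
  by (simp add: is_subst_wsub wsub_def Dom_def hopat_eta_var del: split_paired_All)

lemma is_subst_agree:
  assumes "is_subst \<sigma>" "finite A" "\<And>X. X \<notin> A \<Longrightarrow> \<theta> X = \<sigma> X"
    "\<And>X. X \<in> A \<Longrightarrow> hopat [] (\<theta> X) (snd X)"
  shows "is_subst \<theta>"
proof -
  have "Dom \<theta> \<subseteq> Dom \<sigma> \<union> A" using assms(3) by (auto simp: Dom_def simp del: split_paired_All)
  then have "finite (Dom \<theta>)" using assms(1,2) by (meson finite_UnI finite_subset is_subst_wsub)
  moreover have "hopat [] (\<theta> X) (snd X)" for X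
    using assms(3,4)[of X] wsubD[OF is_substD[OF assms(1)], of X] by (cases "X \<in> A") simp_all
  ultimately show ?thesis by (simp add: is_subst_wsub wsub_def del: split_paired_All)
qed

lemma is_subst_comp:
  assumes "is_subst \<sigma>" "is_subst \<theta>"
  shows "is_subst (comp \<sigma> \<theta>)"
proof -
  have "comp \<sigma> \<theta> X = \<theta> X" if "\<sigma> X = eta_var X" for X
    using that assms(2) by (simp add: comp_def sapp_eta_var is_substD)
  then have "Dom (comp \<sigma> \<theta>) \<subseteq> Dom \<sigma> \<union> Dom \<theta>" unfolding Dom_def by fastforce
  then have "finite (Dom (comp \<sigma> \<theta>))" using assms by (meson finite_UnI finite_subset is_subst_wsub)
  then show ?thesis using assms by (simp add: is_subst_wsub wsub_comp)
qed

lemma finite_fv [simp]: "finite (fv t)"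
proof (induction t)
  case (Ap h ts)
  then show ?case by (cases h) auto
qed simp

lemma finite_cvars: "finite P \<Longrightarrow> is_subst \<sigma> \<Longrightarrow> finite (cvars P \<sigma>)"
  by (auto simp: cvars_def is_subst_wsub)

text \<open>A bound on the names alone yields fresh variables of every type at once, as VE1
  requires.\<close>

lemma fresh_names:
  assumes "finite (A :: var set)"
  obtains N where "\<And>n T. N \<le> n \<Longrightarrow> (n, T) \<notin> A"
proof -
  have "finite (fst ` A)" using assms by simp
  then obtain N where "\<forall>n\<in>fst ` A. n < N" using finite_nat_set_iff_bounded by blast
  then have "(n, T) \<notin> A" if "N \<le> n" for n T using that by force
  with that show ?thesis by blast
qed

text \<open>
  The surplus for binders and arguments pays for the orientation flag that \<open>weight\<close> adds to each of
  the equations created by Abs and Dec.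
\<close>

fun sz :: "trm \<Rightarrow> nat" where
  "sz (Lam T t) = 2 + sz t"
| "sz (Ap h ts) = Suc (sum_list (map (\<lambda>t. Suc (sz t)) ts))"

lemma sz_pos [simp]: "0 < sz t"
  by (cases t) auto

lemma sz_rn [simp]: "sz (rn f t) = sz t"
proof (induction t arbitrary: f)
  case (Ap h ts)
  then have "map (\<lambda>t. Suc (sz t)) (map (rn f) ts) = map (\<lambda>t. Suc (sz t)) ts" by auto
  then show ?case by (metis ren.simps(2) sz.simps(2))
qed simp

lemma sz_arg: "t \<in> set ts \<Longrightarrow> sz t < sz (Ap h ts)"
  using member_le_sum_list[of "Suc (sz t)" "map (\<lambda>t. Suc (sz t)) ts"] by force

text \<open>Each occurrence of \<open>F\<close> is replaced by a renamed copy of its whole body, and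
  renaming preserves \<open>sz\<close>.\<close>

lemma sz_occurs:
  assumes "hopat \<Gamma> t T" "F \<in> fv t" "wsub \<psi>"
  shows "sz (strip (length (argtys (snd F))) (\<psi> F)) \<le> sz (sapp \<psi> t)"
  using assms(1,2)
proof (induction rule: hopat_pattern_induct)
  case (Rigid \<Gamma> h ts Ts b)
  then have "fvh h = {}" by (cases h) auto
  with Rigid.prems obtain i where i: "i < length ts" "F \<in> fv (ts ! i)" by (auto simp: in_set_conv_nth)
  then have "sz (strip (length (argtys (snd F))) (\<psi> F)) \<le> sz (sapp \<psi> (ts ! i))" by (rule Rigid.IH)
  also have "\<dots> < sz (Ap h (map (sapp \<psi>) ts))" using i by (intro sz_arg) auto
  finally show ?case using Rigid.hyps by (simp add: rigid_in_noFV del: sz.simps)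
next
  case (Flex \<Gamma> "is" X b)
  then show ?case by (simp add: sapp_flex del: fv.simps)
qed auto

text \<open>\<open>0 < d\<close> separates similar heads from the value 0 that \<open>RA\<close>
  gives to incomparable ones; \<open>d \<le> 1\<close> makes the thresholded relation
  reflexive.\<close>

locale similarity_degree =
  fixes Rc :: "const \<Rightarrow> const \<Rightarrow> real" and d :: real
  assumes Rc: "similarity Rc" and d_pos: "0 < d" and d_le: "d \<le> 1"
begin

definition simh :: "hd \<Rightarrow> hd \<Rightarrow> bool" where
  "simh h g \<longleftrightarrow> d \<le> RA Rc h g"

definition sim :: "trm \<Rightarrow> trm \<Rightarrow> bool" where
  "sim t s \<longleftrightarrow> d \<le> Rt Rc t s"

lemma simh_simps [simp]:
  "simh (BV i T) g \<longleftrightarrow> g = BV i T" "simh g (BV i T) \<longleftrightarrow> g = BV i T"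
  "simh (FV X) g \<longleftrightarrow> g = FV X" "simh g (FV X) \<longleftrightarrow> g = FV X"
  "simh (C c) g \<longleftrightarrow> (\<exists>c'. g = C c' \<and> d \<le> Rc c c')"
  using d_pos d_le by (cases g; auto simp: simh_def)+

lemma simh_refl [simp]: "simh h h"
  using d_le Rc by (cases h) (auto simp: similarity_def)

lemma simh_sym: "simh h g \<Longrightarrow> simh g h"
  using Rc by (cases h) (auto simp: similarity_def)

text \<open>The minimum is idempotent, so chaining two comparisons at threshold \<open>d\<close>
  loses no degree. This is what permits arbitrarily long chains along a run.\<close>

lemma simh_trans: "simh h g \<Longrightarrow> simh g k \<Longrightarrow> simh h k"
proof (cases h)
  case (C c)
  assume "simh h g" "simh g k"
  with C obtain c1 c2 where "g = C c1" "k = C c2" "d \<le> Rc c c1" "d \<le> Rc c1 c2" by auto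
  moreover have "min (Rc c c1) (Rc c1 c2) \<le> Rc c c2" using Rc unfolding similarity_def by blast
  ultimately show ?thesis using C by auto
qed auto

text \<open>Constants of different types have similarity 0, which is below \<open>d\<close>. Hence
  the arguments paired under similar heads have matching types.\<close>

lemma simh_headty: "simh h g \<Longrightarrow> headty h = headty g"
proof (cases h)
  case (C c)
  assume "simh h g"
  with C obtain c1 where "g = C c1" "d \<le> Rc c c1" by auto
  moreover have "snd c \<noteq> snd c1 \<longrightarrow> Rc c c1 = 0" using Rc unfolding similarity_def by blast
  ultimately show ?thesis using C d_pos by auto
qed auto

lemma sim_list: "d \<le> Rl Rc ts ss \<longleftrightarrow> list_all2 sim ts ss"
proof (induction ts arbitrary: ss)
  case Nil
  then show ?case using d_pos d_le by (cases ss) auto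
next
  case (Cons t ts)
  then show ?case using d_pos by (cases ss) (auto simp: sim_def)
qed

lemma sim_simps [simp]:
  "sim (Lam T t) (Lam U s) \<longleftrightarrow> T = U \<and> sim t s"
  "sim (Ap h ts) (Ap g ss) \<longleftrightarrow> simh h g \<and> list_all2 sim ts ss"
  "\<not> sim (Lam T t) (Ap g ss)" "\<not> sim (Ap h ts) (Lam U s)"
  using d_pos by (auto simp: sim_def simh_def simp flip: sim_list)
    (auto simp: sim_list dest: list_all2_lengthD)

lemma sim_LamE: assumes "sim (Lam T t) s" obtains u where "s = Lam T u" "sim t u"
  using assms by (cases s) auto

lemma sim_ApE: assumes "sim (Ap h ts) s"
  obtains g ss where "s = Ap g ss" "simh h g" "list_all2 sim ts ss"
  using assms by (cases s) auto

lemma sim_refl [simp]: "sim t t"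
  by (induction t) (auto intro: list.rel_refl_strong)

lemma sim_sym: "sim t s \<Longrightarrow> sim s t"
proof (induction t arbitrary: s)
  case (Ap h ts)
  then show ?case
    by (elim sim_ApE) (auto simp: simh_sym list_all2_conv_all_nth)
qed (auto elim: sim_LamE)

lemma sim_trans: "sim t s \<Longrightarrow> sim s u \<Longrightarrow> sim t u"
proof (induction t arbitrary: s u)
  case (Lam T t)
  then show ?case by (metis sim_LamE sim_simps(1))
next
  case (Ap h ts)
  obtain g ss where g: "s = Ap g ss" "simh h g" "list_all2 sim ts ss" using Ap.prems(1) by (rule sim_ApE)
  obtain k us where k: "u = Ap k us" "simh g k" "list_all2 sim ss us"
    using Ap.prems(2) unfolding g by (rule sim_ApE)
  have "list_all2 sim ts us"
    using g(3) k(3) Ap.IH by (auto simp: list_all2_conv_all_nth)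
  with g k show ?case by (auto intro: simh_trans)
qed

lemma sim_mk_abs [simp]: "sim (mk_abs Ts t) (mk_abs Ts s) \<longleftrightarrow> sim t s"
  by (induction Ts) auto

lemma sim_rn: "sim t s \<Longrightarrow> sim (rn f t) (rn f s)"
proof (induction t arbitrary: s f)
  case (Lam T t)
  from Lam.prems obtain u where "s = Lam T u" "sim t u" by (rule sim_LamE)
  with Lam.IH show ?case by simp
next
  case (Ap h ts)
  from Ap.prems obtain g ss where g: "s = Ap g ss" "simh h g" "list_all2 sim ts ss" by (rule sim_ApE)
  have "simh (renh f 0 h) (renh f 0 g)" using g(2) by (cases h) auto
  with g Ap.IH show ?case by (auto simp: list_all2_conv_all_nth)
qed

lemma sim_bv: "sim t s \<Longrightarrow> bv t = bv s"
proof (induction t arbitrary: s)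
  case (Lam T t)
  from Lam.prems obtain u where "s = Lam T u" "sim t u" by (rule sim_LamE)
  with Lam.IH show ?case by simp
next
  case (Ap h ts)
  from Ap.prems obtain g ss where g: "s = Ap g ss" "simh h g" "list_all2 sim ts ss" by (rule sim_ApE)
  have "bvh h = bvh g" using g(2) by (cases h) auto
  moreover have "map bv ts = map bv ss"
    using g(3) Ap.IH by (auto simp: list_all2_conv_all_nth intro!: nth_equalityI)
  ultimately show ?case unfolding g bv.simps by simp
qed

lemma sim_sz: "sim t s \<Longrightarrow> sz t = sz s"
proof (induction t arbitrary: s)
  case (Lam T t)
  from Lam.prems obtain u where "s = Lam T u" "sim t u" by (rule sim_LamE)
  with Lam.IH show ?case by simp
next
  case (Ap h ts)
  from Ap.prems obtain g ss where g: "s = Ap g ss" "simh h g" "list_all2 sim ts ss" by (rule sim_ApE)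
  have "map (\<lambda>t. Suc (sz t)) ts = map (\<lambda>t. Suc (sz t)) ss"
    using g(3) Ap.IH by (auto simp: list_all2_conv_all_nth intro!: nth_equalityI)
  then show ?case unfolding g sz.simps by simp
qed

text \<open>Bound variables are similar only if equal, so each loose occurrence in \<open>t\<close>
  forces the two renamings to coincide there.\<close>

lemma sim_rn_same: "sim (rn f t) (rn g t) \<Longrightarrow> i \<in> bv t \<Longrightarrow> f i = g i"
proof (induction t arbitrary: f g i)
  case (Lam T t)
  then have "up f (Suc i) = up g (Suc i)" by (intro Lam.IH) auto
  then show ?case by simp
next
  case (Ap h ts)
  from Ap.prems(2) consider "i \<in> bvh h" | t where "t \<in> set ts" "i \<in> bv t" by auto
  then show ?case
  proof cases
    case 1
    then show ?thesis using Ap.prems(1) by (cases h) auto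
  next
    case 2
    then have "sim (rn f t) (rn g t)" using Ap.prems(1)
      by (auto simp: list_all2_conv_all_nth in_set_conv_nth)
    then show ?thesis using 2 Ap.IH by blast
  qed
qed

lemma sim_sapp:
  assumes "hopat \<Gamma> t T" "\<And>X. X \<in> fv t \<Longrightarrow> sim (\<sigma> X) (\<theta> X)" "wsub \<sigma>" "wsub \<theta>"
  shows "sim (sapp \<sigma> t) (sapp \<theta> t)"
  using assms(1,2)
proof (induction rule: hopat_pattern_induct)
  case (Rigid \<Gamma> h ts Ts b)
  have "sim (sapp \<sigma> (ts ! i)) (sapp \<theta> (ts ! i))" if "i < length ts" for i
    by (rule Rigid.IH[OF that]) (use Rigid.prems that in \<open>simp, blast intro: nth_mem\<close>)
  with Rigid.hyps show ?case by (simp add: rigid_in_noFV list_all2_conv_all_nth)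
next
  case (Flex \<Gamma> "is" X b)
  obtain u where u: "\<sigma> X = mk_abs (map ((!) \<Gamma>) is) u" "hopat (rev (map ((!) \<Gamma>) is)) u (Base b)"
    "\<forall>\<Delta>. sapp \<sigma> (Ap (FV X) (bva \<Delta> is)) = rn (look is) u" "bv u \<subseteq> {..<length is}"
    by (rule wsub_flex[OF assms(3) Flex(3)])
  obtain v where v: "\<theta> X = mk_abs (map ((!) \<Gamma>) is) v" "hopat (rev (map ((!) \<Gamma>) is)) v (Base b)"
    "\<forall>\<Delta>. sapp \<theta> (Ap (FV X) (bva \<Delta> is)) = rn (look is) v" "bv v \<subseteq> {..<length is}"
    by (rule wsub_flex[OF assms(4) Flex(3)])
  have "sim (\<sigma> X) (\<theta> X)" using Flex(4)[of X] by (simp del: fv.simps)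
  then have "sim u v" using u(1) v(1) by simp
  then show ?case using u(3) v(3) by (simp add: sim_rn)
qed auto

text \<open>\<open>S\<close> stands for the variables in scope. Nothing can be demanded elsewhere,
  as \<open>\<psi>'\<close> departs from \<open>\<psi>\<close> at the fresh variables.\<close>

lemma sim_factor:
  assumes "wsub \<theta>" "wsub \<psi>'" "wsub \<psi>" "\<forall>X\<in>S. sim (sapp \<psi>' (\<theta> X)) (\<psi> X)"
    "hopat \<Gamma> t T" "fv t \<subseteq> S"
  shows "sim (sapp \<psi>' (sapp \<theta> t)) (sapp \<psi> t)"
  unfolding sapp_comp[OF assms(5,1,2)]
proof (rule sim_sapp[OF assms(5)])
  show "sim (comp \<theta> \<psi>' X) (\<psi> X)" if "X \<in> fv t" for X
    unfolding comp_def using that assms(4,6) by blast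
qed (use assms(1-3) in \<open>simp_all add: wsub_comp\<close>)

lemma sim_factor_eqn:
  assumes "wsub \<theta>" "wsub \<psi>'" "wsub \<psi>" "\<forall>X\<in>S. sim (sapp \<psi>' (\<theta> X)) (\<psi> X)"
    "hopat \<Gamma> l T" "fv l \<subseteq> S" "hopat \<Delta> r U" "fv r \<subseteq> S" "sim (sapp \<psi> l) (sapp \<psi> r)"
  shows "sim (sapp \<psi>' (sapp \<theta> l)) (sapp \<psi>' (sapp \<theta> r))"
  using sim_factor[OF assms(1-4) assms(5,6)] sim_factor[OF assms(1-4) assms(7,8)] assms(9)
  by (blast intro: sim_trans sim_sym)

section \<open>Occurs check and the bindings introduced by single rules\<close>

lemma not_sim_occurs:
  assumes "hopat \<Gamma> (Ap (FV F) xs) T" "hopat \<Gamma> (Ap a ss) T" "\<And>X. a \<noteq> FV X" "wsub \<psi>"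
    "sim (sapp \<psi> (Ap (FV F) xs)) (sapp \<psi> (Ap a ss))"
  shows "F \<notin> fv (Ap a ss)"
proof
  assume F: "F \<in> fv (Ap a ss)"
  obtain "is" b where xi: "xs = bva \<Gamma> is" "distinct is" "set is \<subseteq> {..<length \<Gamma>}"
    "snd F = arrows (map ((!) \<Gamma>) is) (Base b)" "T = Base b"
    using assms(1) by (rule hopat_flexE)
  obtain Ts c where r: "rigid_in \<Gamma> a" "headty a = arrows Ts (Base c)" "length ss = length Ts"
    "\<forall>i<length ss. hopat \<Gamma> (ss ! i) (Ts ! i)" "T = Base c"
    using assms(2,3) by (rule hopat_rigidE)
  \<comment> \<open>A rigid head puts the occurrence of \<open>F\<close> inside an argument, and
    passing to an argument makes the size inequality strict.\<close>
  have "fvh a = {}" using assms(3) by (cases a) auto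
  with F obtain i where i: "i < length ss" "F \<in> fv (ss ! i)" by (auto simp: in_set_conv_nth)
  have "sz (sapp \<psi> (Ap (FV F) xs)) = sz (strip (length (argtys (snd F))) (\<psi> F))"
    using xi by (simp add: sapp_flex del: fv.simps)
  also have "\<dots> \<le> sz (sapp \<psi> (ss ! i))" by (rule sz_occurs[OF r(4)[rule_format, OF i(1)] i(2) assms(4)])
  also have "\<dots> < sz (Ap a (map (sapp \<psi>) ss))" using i by (intro sz_arg) auto
  finally show False using sim_sz[OF assms(5)] assms(3) by simp
qed

text \<open>Common to SV and VE2, where a single fresh variable \<open>H\<close> takes over the
  instance \<open>w\<close>. The abstraction list \<open>is\<close> is independent of
  \<open>ks\<close>, so that either side of an equation can be treated.\<close>

lemma flex_bind:
  assumes "is_subst \<psi>" "hopat \<Gamma> w (Base b)" "bv w \<subseteq> set ks" "distinct ks" "set ks \<subseteq> {..<length \<Gamma>}"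
    "snd H = arrows (map ((!) \<Gamma>) ks) (Base b)"
    and \<psi>': "\<psi>' = \<psi>(H := mk_abs (map ((!) \<Gamma>) ks) (rn (unlook ks) w))"
  shows "is_subst \<psi>'"
    "sapp \<psi>' (mk_abs Ts (rn (unlook is) (Ap (FV H) (bva \<Gamma> ks)))) = mk_abs Ts (rn (unlook is) w)"
proof -
  show s: "is_subst \<psi>'"
    by (rule is_subst_agree[OF assms(1), of "{H}"])
      (use hopat_abstr[OF assms(2,3)] assms(6) \<psi>' in auto)
  have "hopat \<Gamma> (Ap (FV H) (bva \<Gamma> ks)) (Base b)" by (rule hopat_flexI[OF assms(4-6)])
  moreover have "sapp \<psi>' (Ap (FV H) (bva \<Gamma> ks)) = w"
    by (rule sapp_abstr_inst) (use \<psi>' assms(3) in auto)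
  ultimately show "sapp \<psi>' (mk_abs Ts (rn (unlook is) (Ap (FV H) (bva \<Gamma> ks)))) = mk_abs Ts (rn (unlook is) w)"
    using sapp_rn is_substD[OF s] by (metis sapp_mk_abs)
qed

text \<open>The body of \<open>\<psi> F\<close> is renamed along both argument lists with similar
  results, so by \<open>sim_rn_same\<close> it uses only positions where the lists agree. Those are
  the positions that \<open>H\<close> retains.\<close>

lemma sv_step:
  assumes "hopat \<Gamma> (Ap (FV F) xs) T" "hopat \<Gamma> (Ap (FV F) ys) T" "is_subst \<psi>"
    "sim (sapp \<psi> (Ap (FV F) xs)) (sapp \<psi> (Ap (FV F) ys))"
    "zs = map fst (filter (\<lambda>(x, y). x = y) (zip xs ys))" "H \<notin> S"
    "snd H = arrows (map typeof zs) (resty (snd F))"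
    "\<theta> = single F (abstr (argtys (snd F)) xs (Ap (FV H) zs))"
  shows "is_subst \<theta>" "\<exists>\<psi>'. is_subst \<psi>' \<and> (\<forall>X\<in>S. sim (sapp \<psi>' (\<theta> X)) (\<psi> X))"
proof -
  obtain "is" b where xi: "xs = bva \<Gamma> is" "distinct is" "set is \<subseteq> {..<length \<Gamma>}"
    "snd F = arrows (map ((!) \<Gamma>) is) (Base b)" "T = Base b"
    using assms(1) by (rule hopat_flexE)
  obtain js c where js: "ys = bva \<Gamma> js" "distinct js" "set js \<subseteq> {..<length \<Gamma>}"
    "snd F = arrows (map ((!) \<Gamma>) js) (Base c)" "T = Base c"
    using assms(2) by (rule hopat_flexE)
  have len: "length is = length js" using xi(4) js(4) by (metis argtys_arrows append_same_eq
      xi(5) js(5) length_map)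
  define ks where "ks = map fst (filter (\<lambda>(i, j). i = j) (zip is js))"
  have zs: "zs = bva \<Gamma> ks"
    unfolding assms(5) xi(1) js(1) ks_def bva_def
    by (auto simp: zip_map_map filter_map o_def split_beta intro!: arg_cong[where f = "map _"] filter_cong)
  have sub: "set ks \<subseteq> set is" by (auto simp: ks_def dest: set_zip_leftD)
  have dk: "distinct ks" unfolding ks_def
    by (rule distinct_map_filter) (simp add: xi(2) len)
  let ?w = "sapp \<psi> (Ap (FV F) xs)"
  have w: "hopat \<Gamma> ?w (Base b)" using hopat_sapp[OF assms(1)] assms(3) xi(5) by blast
  obtain u where u: "\<psi> F = mk_abs (map ((!) \<Gamma>) is) u" "hopat (rev (map ((!) \<Gamma>) is)) u (Base b)"
    "\<forall>\<Delta>. sapp \<psi> (Ap (FV F) (bva \<Delta> is)) = rn (look is) u" "bv u \<subseteq> {..<length is}"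
    by (rule wsub_flex[OF is_substD[OF assms(3)] xi(4)])
  have "sapp \<psi> (Ap (FV F) ys) = rn (look js) u"
    unfolding js(1) sapp_flex using u(1) len strip_mk_abs[of "map ((!) \<Gamma>) is" u] by simp
  with assms(4) u(3) xi(1) have eq: "look is i = look js i" if "i \<in> bv u" for i
    using sim_rn_same that by metis
  have "look is i \<in> set ks" if "i \<in> bv u" for i
  proof -
    have i: "i < length is" using that u(4) by auto
    \<comment> \<open>Index \<open>i\<close> of the body denotes the argument at position
      \<open>length is - 1 - i\<close>, so equal images mean equal entries at one position.\<close>
    then have "is ! (length is - 1 - i) = js ! (length is - 1 - i)"
      using eq[OF that] len by (simp add: look_def)
    with i len have "(look is i, look is i) \<in> set (zip is js)"
      by (auto simp: in_set_zip look_def intro!: exI[of _ "length is - Suc i"])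
    then show ?thesis by (force simp: ks_def)
  qed
  then have bvw: "bv ?w \<subseteq> set ks" using u(3) xi(1) by (auto simp: bv_rn)
  have H: "snd H = arrows (map ((!) \<Gamma>) ks) (Base b)" using assms(7) zs xi(4) by simp
  have \<theta>F: "\<theta> F = mk_abs (map ((!) \<Gamma>) is) (rn (unlook is) (Ap (FV H) (bva \<Gamma> ks)))"
    using xi(1,4) zs by (simp add: assms(8) single_def)
  have "hopat \<Gamma> (Ap (FV H) (bva \<Gamma> ks)) (Base b)"
    by (rule hopat_flexI) (use dk sub xi(3) H in auto)
  then have "hopat [] (\<theta> F) (snd F)" unfolding \<theta>F xi(4) by (rule hopat_abstr) (use sub in \<open>simp del: bv.simps\<close>)
  then show "is_subst \<theta>"
    by (intro is_subst_agree[OF is_subst_eps, of "{F}"]) (auto simp: assms(8) single_def)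
  define \<psi>' where "\<psi>' = \<psi>(H := mk_abs (map ((!) \<Gamma>) ks) (rn (unlook ks) ?w))"
  note fb = flex_bind[OF assms(3) w bvw dk _ H \<psi>'_def]
  have s: "is_subst \<psi>'" using fb(1) sub xi(3) by blast
  have "sapp \<psi>' (\<theta> F) = \<psi> F"
    unfolding \<theta>F using fb(2) sub xi(3) abstr_sapp_inst[OF is_substD[OF assms(3)] xi(4,2), of \<Gamma>] xi(1) by auto
  moreover have "sapp \<psi>' (\<theta> X) = \<psi> X" if "X \<in> S" "X \<noteq> F" for X
    using that assms(6) sapp_eta_var[OF is_substD[OF s]] by (auto simp: assms(8) single_def \<psi>'_def)
  ultimately have "\<forall>X\<in>S. sim (sapp \<psi>' (\<theta> X)) (\<psi> X)" by (metis sim_refl)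
  with s show "\<exists>\<psi>'. is_subst \<psi>' \<and> (\<forall>X\<in>S. sim (sapp \<psi>' (\<theta> X)) (\<psi> X))" by blast
qed

text \<open>Similar terms have the same loose indices, so the common instance mentions only indices
  from both argument lists. Since \<open>H\<close> takes over the left instance, agreement with
  \<open>\<psi>\<close> is exact at \<open>F\<close> and holds up to similarity at
  \<open>G\<close>.\<close>

lemma ve2_step:
  assumes "hopat \<Gamma> (Ap (FV F) xs) T" "hopat \<Gamma> (Ap (FV G) ys) T" "is_subst \<psi>"
    "sim (sapp \<psi> (Ap (FV F) xs)) (sapp \<psi> (Ap (FV G) ys))" "F \<noteq> G"
    "zs = filter (\<lambda>x. x \<in> set ys) xs" "H \<notin> S"
    "snd H = arrows (map typeof zs) (resty (snd F))"
    "\<theta> = (eta_var(F := abstr (argtys (snd F)) xs (Ap (FV H) zs),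
                  G := abstr (argtys (snd G)) ys (Ap (FV H) zs)))"
  shows "is_subst \<theta>" "\<exists>\<psi>'. is_subst \<psi>' \<and> (\<forall>X\<in>S. sim (sapp \<psi>' (\<theta> X)) (\<psi> X))"
    "fv (\<theta> F) = {H}" "fv (\<theta> G) = {H}"
proof -
  obtain "is" b where xi: "xs = bva \<Gamma> is" "distinct is" "set is \<subseteq> {..<length \<Gamma>}"
    "snd F = arrows (map ((!) \<Gamma>) is) (Base b)" "T = Base b"
    using assms(1) by (rule hopat_flexE)
  obtain js c where js: "ys = bva \<Gamma> js" "distinct js" "set js \<subseteq> {..<length \<Gamma>}"
    "snd G = arrows (map ((!) \<Gamma>) js) (Base c)" "T = Base c"
    using assms(2) by (rule hopat_flexE)
  have bc: "c = b" using xi(5) js(5) by simp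
  define ks where "ks = filter (\<lambda>i. i \<in> set js) is"
  have zs: "zs = bva \<Gamma> ks"
    unfolding assms(6) xi(1) js(1) ks_def bva_def
    by (auto simp: filter_map o_def intro!: arg_cong[where f = "map _"] filter_cong)
  have sub: "set ks \<subseteq> set is" "set ks \<subseteq> set js" by (auto simp: ks_def)
  have dk: "distinct ks" using xi(2) by (simp add: ks_def)
  let ?w = "sapp \<psi> (Ap (FV F) xs)"
  have w: "hopat \<Gamma> ?w (Base b)" using hopat_sapp[OF assms(1)] assms(3) xi(5) by blast
  have ws: "wsub \<psi>" using assms(3) by blast
  have "bv ?w \<subseteq> set is" using bv_sapp_flex[OF ws xi(4)] xi(1) by simp
  moreover have "bv ?w \<subseteq> set js" using bv_sapp_flex[OF ws js(4)] js(1) sim_bv[OF assms(4)] by simp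
  ultimately have bvw: "bv ?w \<subseteq> set ks" by (auto simp: ks_def)
  have H: "snd H = arrows (map ((!) \<Gamma>) ks) (Base b)" using assms(8) zs xi(4) by simp
  have \<theta>F: "\<theta> F = mk_abs (map ((!) \<Gamma>) is) (rn (unlook is) (Ap (FV H) (bva \<Gamma> ks)))"
    using xi(1,4) zs assms(5) by (simp add: assms(9))
  have \<theta>G: "\<theta> G = mk_abs (map ((!) \<Gamma>) js) (rn (unlook js) (Ap (FV H) (bva \<Gamma> ks)))"
    using js(1,4) zs assms(5) by (simp add: assms(9))
  show "fv (\<theta> F) = {H}" "fv (\<theta> G) = {H}" unfolding \<theta>F \<theta>G by (simp_all del: fv.simps ren.simps)
  have h: "hopat \<Gamma> (Ap (FV H) (bva \<Gamma> ks)) (Base b)"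
    by (rule hopat_flexI) (use dk sub xi(3) H in auto)
  then have "hopat [] (\<theta> F) (snd F)" unfolding \<theta>F xi(4) by (rule hopat_abstr) (use sub in \<open>simp del: bv.simps\<close>)
  moreover have "hopat [] (\<theta> G) (snd G)" unfolding \<theta>G js(4) bc using h by (rule hopat_abstr) (use sub in \<open>simp del: bv.simps\<close>)
  ultimately show "is_subst \<theta>"
    by (intro is_subst_agree[OF is_subst_eps, of "{F, G}"]) (auto simp: assms(9))
  define \<psi>' where "\<psi>' = \<psi>(H := mk_abs (map ((!) \<Gamma>) ks) (rn (unlook ks) ?w))"
  note fb = flex_bind[OF assms(3) w bvw dk _ H \<psi>'_def]
  have s: "is_subst \<psi>'" using fb(1) sub xi(3) by blast
  have "sapp \<psi>' (\<theta> F) = \<psi> F"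
    unfolding \<theta>F using fb(2) sub xi(3) abstr_sapp_inst[OF ws xi(4,2), of \<Gamma>] xi(1) by auto
  then have F: "sim (sapp \<psi>' (\<theta> F)) (\<psi> F)" by simp
  have "sapp \<psi>' (\<theta> G) = mk_abs (map ((!) \<Gamma>) js) (rn (unlook js) ?w)"
    unfolding \<theta>G using fb(2) sub xi(3) by auto
  moreover have "\<psi> G = mk_abs (map ((!) \<Gamma>) js) (rn (unlook js) (sapp \<psi> (Ap (FV G) ys)))"
    using abstr_sapp_inst[OF ws js(4,2), of \<Gamma>] js(1) by simp
  ultimately have G: "sim (sapp \<psi>' (\<theta> G)) (\<psi> G)" using assms(4) by (simp add: sim_rn)
  have "sapp \<psi>' (\<theta> X) = \<psi> X" if "X \<in> S" "X \<noteq> F" "X \<noteq> G" for X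
    using that assms(7) sapp_eta_var[OF is_substD[OF s]] by (auto simp: assms(9) \<psi>'_def)
  with F G have "\<forall>X\<in>S. sim (sapp \<psi>' (\<theta> X)) (\<psi> X)" by (metis sim_refl)
  with s show "\<exists>\<psi>'. is_subst \<psi>' \<and> (\<forall>X\<in>S. sim (sapp \<psi>' (\<theta> X)) (\<psi> X))" by blast
qed

text \<open>A bound head survives instantiation, whereas an instance of \<open>F(xs)\<close> has no
  loose index outside \<open>xs\<close>. This supplies the side conditions of Ori, LF and
  VE1.\<close>

lemma head_in_args:
  assumes "hopat \<Gamma> (Ap (FV F) xs) T" "hopat \<Gamma> (Ap a ss) T" "\<And>X. a \<noteq> FV X" "is_subst \<psi>"
    "sim (sapp \<psi> (Ap (FV F) xs)) (sapp \<psi> (Ap a ss))"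
  shows "(\<exists>c. a = C c) \<or> (\<exists>j S. a = BV j S \<and> Ap a [] \<in> set xs)"
proof (cases a)
  case (BV j S)
  obtain "is" b where xi: "xs = bva \<Gamma> is" "distinct is" "set is \<subseteq> {..<length \<Gamma>}"
    "snd F = arrows (map ((!) \<Gamma>) is) (Base b)" "T = Base b"
    using assms(1) by (rule hopat_flexE)
  have "j \<in> bv (sapp \<psi> (Ap a ss))" using BV by simp
  then have "j \<in> set is" using sim_bv[OF assms(5)] bv_sapp_flex[OF is_substD[OF assms(4)] xi(4), of \<Gamma>] xi(1) by auto
  moreover have "\<Gamma> ! j = S" using assms(2) BV by cases auto
  ultimately show ?thesis using BV xi(1) by (auto simp: mem_bva)
qed (use assms(3) in auto)

text \<open>Imitation or projection: the fresh variables take over the arguments of the instance of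
  \<open>F(xs)\<close>. Exact agreement of \<open>\<psi>'\<close> with \<open>\<psi>\<close> on
  \<open>S\<close> is recorded as well, for equations to which the binding is not applied; the
  strict bound on sizes serves termination.\<close>

lemma ve1_step:
  assumes "hopat \<Gamma> (Ap (FV F) xs) T" "hopat \<Gamma> (Ap a ss) T" "is_subst \<psi>"
    "sim (sapp \<psi> (Ap (FV F) xs)) (sapp \<psi> (Ap a ss))"
    "(\<exists>c. a = C c) \<or> (\<exists>j S. a = BV j S \<and> Ap a [] \<in> set xs)"
    "length Hs = length ss" "distinct Hs" "\<forall>H\<in>set Hs. H \<notin> S"
    "\<forall>i<length ss. snd (Hs ! i) = arrows (map typeof xs) (argtys (headty a) ! i)"
    and E: "E = (\<lambda>i. eta_app (Hs ! i) xs (argtys (headty a) ! i))"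
    and \<theta>: "\<theta> = single F (abstr (argtys (snd F)) xs (Ap a (map E [0..<length ss])))"
  shows "is_subst \<theta>"
    "\<And>i. i < length ss \<Longrightarrow> hopat \<Gamma> (E i) (argtys (headty a) ! i) \<and>
        hopat \<Gamma> (ss ! i) (argtys (headty a) ! i) \<and> fv (E i) = {Hs ! i}"
    "\<exists>\<psi>'. is_subst \<psi>' \<and> (\<forall>X\<in>S. sim (sapp \<psi>' (\<theta> X)) (\<psi> X)) \<and> (\<forall>X\<in>S. \<psi>' X = \<psi> X) \<and>
       (\<forall>i<length ss. sim (sapp \<psi>' (E i)) (sapp \<psi> (ss ! i))) \<and>
       (\<Sum>i<length ss. sz (sapp \<psi>' (E i))) < sz (sapp \<psi> (Ap (FV F) xs))"
proof -
  have noFV: "\<And>X. a \<noteq> FV X" using assms(5) by auto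
  obtain "is" b where xi: "xs = bva \<Gamma> is" "distinct is" "set is \<subseteq> {..<length \<Gamma>}"
    "snd F = arrows (map ((!) \<Gamma>) is) (Base b)" "T = Base b"
    using assms(1) by (rule hopat_flexE)
  obtain Ts c where r: "rigid_in \<Gamma> a" "headty a = arrows Ts (Base c)" "length ss = length Ts"
    "\<forall>i<length ss. hopat \<Gamma> (ss ! i) (Ts ! i)" "T = Base c"
    using assms(2) noFV by (rule hopat_rigidE)
  have ws: "wsub \<psi>" using assms(3) by blast
  have Ts: "argtys (headty a) = Ts" using r(2) by simp
  have Ei: "E i = eta_app (Hs ! i) (bva \<Gamma> is) (Ts ! i)" for i by (simp add: E xi(1) Ts)
  have snd_Hs: "snd (Hs ! i) = arrows (map ((!) \<Gamma>) is) (Ts ! i)" if "i < length ss" for i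
    using assms(9) that xi(1) Ts by simp
  have hE: "hopat \<Gamma> (E i) (Ts ! i)" if "i < length ss" for i
    unfolding Ei by (rule hopat_eta_app[OF xi(2,3) snd_Hs[OF that]])
  then show "\<And>i. i < length ss \<Longrightarrow> hopat \<Gamma> (E i) (argtys (headty a) ! i) \<and>
        hopat \<Gamma> (ss ! i) (argtys (headty a) ! i) \<and> fv (E i) = {Hs ! i}"
    using r(4) by (simp add: Ts Ei)
  let ?u = "Ap a (map E [0..<length ss])"
  have hu: "hopat \<Gamma> ?u (Base b)"
    by (rule hopat_rigidI[OF r(1), where Ts = Ts]) (use r xi(5) hE in auto)
  have "bvh a \<subseteq> set is" using assms(5) xi(1) by (auto simp: mem_bva)
  then have bvu: "bv ?u \<subseteq> set is" by (simp add: Ei UN_subset_iff bv_eta_app)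
  have \<theta>F: "\<theta> F = mk_abs (map ((!) \<Gamma>) is) (rn (unlook is) ?u)"
    using xi(1,4) by (simp add: \<theta> single_def del: ren.simps)
  have "hopat [] (\<theta> F) (snd F)" unfolding \<theta>F xi(4) by (rule hopat_abstr[OF hu bvu])
  then show "is_subst \<theta>"
    by (intro is_subst_agree[OF is_subst_eps, of "{F}"]) (auto simp: \<theta> single_def)
  let ?w = "sapp \<psi> (Ap (FV F) xs)"
  have w: "hopat \<Gamma> ?w (Base b)" using hopat_sapp[OF assms(1) ws] xi(5) by simp
  have bvw: "bv ?w \<subseteq> set is" using bv_sapp_flex[OF ws xi(4)] xi(1) by simp
  \<comment> \<open>\<open>a\<close> is rigid, so the instance of \<open>F(xs)\<close> must have a
    head \<open>a'\<close> similar to \<open>a\<close>; its arguments \<open>us\<close> are the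
    terms the fresh variables have to denote.\<close>
  have "sim (Ap a (map (sapp \<psi>) ss)) ?w" using sim_sym[OF assms(4)] noFV by simp
  then obtain a' us where us: "?w = Ap a' us" "simh a a'" "list_all2 sim (map (sapp \<psi>) ss) us"
    by (rule sim_ApE)
  have a': "\<And>X. a' \<noteq> FV X" using us(2) noFV by (metis simh_simps(4))
  obtain Us b' where Us: "rigid_in \<Gamma> a'" "headty a' = arrows Us (Base b')" "length us = length Us"
    "\<forall>i<length us. hopat \<Gamma> (us ! i) (Us ! i)" "Base b = Base b'"
    using w a' unfolding us(1) by (rule hopat_rigidE)
  have UsTs: "Us = Ts" using simh_headty[OF us(2)] r(2) Us(2) by (metis argtys.simps(1) argtys_arrows append_Nil2)
  have len: "length us = length ss" using us(3) by (auto dest: list_all2_lengthD)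
  have bvus: "bv (us ! i) \<subseteq> set is" if "i < length ss" for i
    using bvw us(1) that len by (simp add: UN_subset_iff)
  \<comment> \<open>\<open>pos\<close> recovers which argument a fresh variable stands for;
    distinctness of \<open>Hs\<close> makes this consistent.\<close>
  define \<psi>' where "\<psi>' X = (if X \<in> set Hs then
      mk_abs (map ((!) \<Gamma>) is) (rn (unlook is) (us ! pos Hs X)) else \<psi> X)" for X
  have s: "is_subst \<psi>'"
  proof (rule is_subst_agree[OF assms(3), of "set Hs"])
    fix X assume "X \<in> set Hs"
    then obtain i where i: "i < length ss" "X = Hs ! i" using assms(6) by (metis in_set_conv_nth)
    then have "\<psi>' X = mk_abs (map ((!) \<Gamma>) is) (rn (unlook is) (us ! i))"
      using assms(6,7) by (simp add: \<psi>'_def pos_nth)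
    then show "hopat [] (\<psi>' X) (snd X)"
      using hopat_abstr[OF Us(4)[rule_format] bvus[OF i(1)]] i len UsTs snd_Hs by simp
  qed (auto simp: \<psi>'_def)
  have inst: "sapp \<psi>' (E i) = us ! i" if "i < length ss" for i
    unfolding Ei
  proof (rule sapp_eta_app)
    show "hopat \<Gamma> (us ! i) (Ts ! i)" using Us(4) len UsTs that by simp
    show "bv (us ! i) \<subseteq> set is" by (rule bvus[OF that])
    show "\<psi>' (Hs ! i) = mk_abs (map ((!) \<Gamma>) is) (rn (unlook is) (us ! i))"
      using that assms(6,7) by (simp add: \<psi>'_def pos_nth)
  qed
  have "sapp \<psi>' ?u = Ap a us"
    using noFV inst len by (auto intro!: nth_equalityI)
  then have "sapp \<psi>' (\<theta> F) = mk_abs (map ((!) \<Gamma>) is) (rn (unlook is) (Ap a us))"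
    unfolding \<theta>F using sapp_rn[OF hu is_substD[OF s]] by (metis sapp_mk_abs)
  moreover have "\<psi> F = mk_abs (map ((!) \<Gamma>) is) (rn (unlook is) (Ap a' us))"
    using abstr_sapp_inst[OF ws xi(4,2), of \<Gamma>] xi(1) us(1) by metis
  \<comment> \<open>The binding carries \<open>a\<close> where \<open>\<psi>\<close> has
    \<open>a'\<close>: agreement at \<open>F\<close> is up to similarity because of this one
    head.\<close>
  moreover have "sim (Ap a us) (Ap a' us)" using us(2) by (auto intro: list.rel_refl_strong)
  ultimately have F: "sim (sapp \<psi>' (\<theta> F)) (\<psi> F)" by (metis sim_mk_abs sim_rn)
  have agree: "\<forall>X\<in>S. \<psi>' X = \<psi> X" using assms(8) by (auto simp: \<psi>'_def)
  have "sapp \<psi>' (\<theta> X) = \<psi> X" if "X \<in> S" "X \<noteq> F" for X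
    using that agree sapp_eta_var[OF is_substD[OF s]] by (auto simp: \<theta> single_def)
  with F have cov: "\<forall>X\<in>S. sim (sapp \<psi>' (\<theta> X)) (\<psi> X)" by (metis sim_refl)
  have "\<forall>i<length ss. sim (sapp \<psi>' (E i)) (sapp \<psi> (ss ! i))"
    using us(3) inst by (auto simp: list_all2_conv_all_nth intro: sim_sym)
  moreover have "(\<Sum>i<length ss. sz (sapp \<psi>' (E i))) < sz ?w"
  proof -
    have "(\<Sum>i<length ss. sz (sapp \<psi>' (E i))) \<le> (\<Sum>i<length us. Suc (sz (us ! i)))"
      unfolding len by (rule sum_mono) (simp add: inst)
    also have "\<dots> = sum_list (map (\<lambda>t. Suc (sz t)) us)"
      by (simp add: sum_list_sum_nth atLeast0LessThan)
    finally show ?thesis unfolding us(1) by simp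
  qed
  ultimately show "\<exists>\<psi>'. is_subst \<psi>' \<and> (\<forall>X\<in>S. sim (sapp \<psi>' (\<theta> X)) (\<psi> X)) \<and> (\<forall>X\<in>S. \<psi>' X = \<psi> X) \<and>
       (\<forall>i<length ss. sim (sapp \<psi>' (E i)) (sapp \<psi> (ss ! i))) \<and>
       (\<Sum>i<length ss. sz (sapp \<psi>' (E i))) < sz ?w"
    using s cov agree by blast
qed

end

section \<open>The procedure VarElim\<close>

declare split_paired_All [simp del] split_paired_Ex [simp del]

text \<open>Each equation has its own context, since stripping a binder from one equation leaves the
  others where they are.\<close>

definition wt :: "eqn set \<Rightarrow> bool" where
  "wt Q \<longleftrightarrow> (\<forall>e\<in>Q. \<exists>\<Gamma> T. hopat \<Gamma> (fst e) T \<and> hopat \<Gamma> (snd e) T)"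

fun flex :: "trm \<Rightarrow> bool" where
  "flex (Ap (FV X) ts) = True"
| "flex _ = False"

text \<open>VE1 puts eta-expanded fresh variables on the left, so left-hand sides in VarElim may be
  flexible only below their binders.\<close>

fun flex_body :: "trm \<Rightarrow> bool" where
  "flex_body (Lam T t) = flex_body t"
| "flex_body (Ap h ts) = flex (Ap h ts)"

text \<open>
  Rule VE1 does not apply its binding of \<open>F\<close> to the rest of the problem; linearity of the left-hand
  sides makes this harmless.
\<close>

definition lhs_linear :: "eqn set \<Rightarrow> bool" where
  "lhs_linear Q \<longleftrightarrow> (\<forall>e\<in>Q. \<forall>e'\<in>Q. fv (fst e) \<inter> fv (snd e') = {} \<and>
     (e \<noteq> e' \<longrightarrow> fv (fst e) \<inter> fv (fst e') = {}))"

definition vars :: "eqn set \<Rightarrow> var set" where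
  "vars Q = (\<Union>e\<in>Q. fv (fst e) \<union> fv (snd e))"

lemma cvars_alt: "cvars P \<sigma> = vars P \<union> Dom \<sigma> \<union> (\<Union>X\<in>Dom \<sigma>. fv (\<sigma> X))"
  by (auto simp: cvars_def vars_def split_beta)

lemma flex_body_eta_app: "flex_body (eta_app H xs T)"
proof -
  have "flex_body (mk_abs Ts u) = flex_body u" for Ts u by (induction Ts) auto
  then show ?thesis by (simp add: eta_app_def)
qed

text \<open>Rigid heads stay rigid under a binding, so a binding cannot raise the orientation flag
  of an equation.\<close>

lemma flex_sapp: "flex (sapp \<theta> t) \<Longrightarrow> flex t"
  by (induction t rule: flex.induct) auto

text \<open>Problems are sets, so a new equation may coincide with one already present; sizes are
  therefore estimated from above.\<close>

lemma sum_Un_le: "finite A \<Longrightarrow> finite B \<Longrightarrow> sum f (A \<union> B) \<le> sum f A + (sum f B :: nat)"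
  using sum.union_inter[of A B f] by linarith

lemma sum_image_le_nat: "finite I \<Longrightarrow> sum g (f ` I) \<le> (\<Sum>i\<in>I. g (f i) :: nat)"
  using sum_image_le[of I g f] by (simp add: o_def)

lemma Papp_alt: "Papp \<theta> P = (\<lambda>e. (sapp \<theta> (fst e), sapp \<theta> (snd e))) ` P"
  by (simp add: Papp_def split_beta)

lemma wt_Papp: "wt P \<Longrightarrow> wsub \<theta> \<Longrightarrow> wt (Papp \<theta> P)"
  unfolding wt_def Papp_alt by (auto, metis fst_conv hopat_sapp snd_conv)

text \<open>Makes the degree of a unifier an admissible threshold and a lower bound for the initial
  degree 1.\<close>

lemma Rt_le_1:
  assumes "similarity Rc"
  shows "Rt Rc t s \<le> 1" and "Rl Rc ts ss \<le> 1"
  by (induction Rc t s and Rc ts ss rule: Rt_Rl.induct) (auto simp: min_le_iff_disj)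

section \<open>Invariant, progress and termination of VarElim\<close>

context similarity_degree
begin

text \<open>\<open>cvars\<close> accounts for the bindings of \<open>\<phi>\<close> on its domain;
  elsewhere the only variable of \<open>\<phi> X\<close> is \<open>X\<close>, which lies in
  \<open>A\<close>. So the agreement of \<open>\<psi>'\<close> covers all of
  \<open>\<phi> X\<close>.\<close>

lemma sim_comp:
  assumes "is_subst \<phi>" "is_subst \<theta>" "is_subst \<psi>'" "is_subst \<psi>"
    "\<forall>X\<in>A \<union> cvars Q \<phi>. sim (sapp \<psi>' (\<theta> X)) (\<psi> X)"
    "X \<in> A" "sim (sapp \<psi> (\<phi> X)) s"
  shows "sim (sapp \<psi>' (comp \<phi> \<theta> X)) s"
proof -
  have "fv (\<phi> X) \<subseteq> A \<union> cvars Q \<phi>"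
  proof (cases "X \<in> Dom \<phi>")
    case True
    then show ?thesis by (auto simp: cvars_alt)
  next
    case False
    then show ?thesis using assms(6) by (simp add: Dom_def)
  qed
  then have "sim (sapp \<psi>' (sapp \<theta> (\<phi> X))) (sapp \<psi> (\<phi> X))"
    by (rule sim_factor[OF is_substD[OF assms(2)] is_substD[OF assms(3)] is_substD[OF assms(4)]
          assms(5) wsubD[OF is_substD[OF assms(1)]]])
  then show ?thesis unfolding comp_def using assms(7) by (rule sim_trans)
qed

text \<open>\<open>A\<close> is the set avoided by fresh variables, \<open>V\<close> the variables
  of the equation handed to VarElim, and \<open>\<psi>\<^sub>0\<close> its unifier. The last two
  clauses ensure that restricting the result to \<open>V\<close> changes nothing on
  \<open>A\<close>.\<close>

definition ve_inv :: "var set \<Rightarrow> var set \<Rightarrow> subst \<Rightarrow> eqn set \<Rightarrow> subst \<Rightarrow> subst \<Rightarrow> bool" where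
  "ve_inv A V \<psi>\<^sub>0 Q \<phi> \<psi> \<longleftrightarrow> finite Q \<and> is_subst \<phi> \<and> is_subst \<psi> \<and> wt Q \<and> lhs_linear Q \<and>
     (\<forall>e\<in>Q. flex_body (fst e) \<and> sim (sapp \<psi> (fst e)) (sapp \<psi> (snd e))) \<and>
     (\<forall>X\<in>A. sim (sapp \<psi> (\<phi> X)) (\<psi>\<^sub>0 X)) \<and> (\<forall>X\<in>A - V. \<phi> X = eta_var X) \<and> vars Q \<inter> A \<subseteq> V"

definition ve_size :: "subst \<Rightarrow> eqn set \<Rightarrow> nat" where
  "ve_size \<psi> Q = (\<Sum>e\<in>Q. sz (sapp \<psi> (fst e)))"

lemma ve_size_remove: "finite Q \<Longrightarrow> e \<in> Q \<Longrightarrow> ve_size \<psi> Q = sz (sapp \<psi> (fst e)) + ve_size \<psi> (Q - {e})"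
  unfolding ve_size_def by (rule sum.remove)

lemma ve_inv_abs:
  assumes inv: "ve_inv A V \<psi>\<^sub>0 Q \<phi> \<psi>" and e: "e = (Lam T t, Lam T s)" "e \<in> Q"
  shows "ve_inv A V \<psi>\<^sub>0 (insert (t, s) (Q - {e})) \<phi> \<psi>"
    "ve_size \<psi> (insert (t, s) (Q - {e})) < ve_size \<psi> Q"
proof -
  let ?Q = "insert (t, s) (Q - {e})"
  have fin: "finite Q" using inv by (simp add: ve_inv_def)
  obtain \<Gamma> U where "hopat \<Gamma> (Lam T t) U" "hopat \<Gamma> (Lam T s) U"
    using inv e by (force simp: ve_inv_def wt_def)
  then have "\<exists>\<Gamma> U. hopat \<Gamma> t U \<and> hopat \<Gamma> s U" by (metis hopat_LamE ty.inject(2))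
  then have "wt ?Q" using inv by (auto simp: ve_inv_def wt_def)
  moreover have "lhs_linear ?Q"
  proof -
    have lin: "lhs_linear Q" using inv by (simp add: ve_inv_def)
    have "fv (fst e1) \<inter> fv (snd e2) = {} \<and> (e1 \<noteq> e2 \<longrightarrow> fv (fst e1) \<inter> fv (fst e2) = {})"
      if e12: "e1 \<in> ?Q" "e2 \<in> ?Q" for e1 e2
    proof -
      \<comment> \<open>Traces an equation of the new problem to one of \<open>Q\<close> with the
        same free variables; injectivity transfers disjointness of distinct left-hand sides.\<close>
      define orig where "orig e' = (if e' \<in> Q - {e} then e' else e)" for e'
      have orig: "orig e' \<in> Q" "fv (fst e') = fv (fst (orig e'))" "fv (snd e') = fv (snd (orig e'))"
        if "e' \<in> ?Q" for e'
        using that e by (auto simp: orig_def)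
      have "orig e1 = orig e2 \<Longrightarrow> e1 = e2" using e12 by (auto simp: orig_def split: if_splits)
      then show ?thesis
        using lin orig[OF e12(1)] orig[OF e12(2)] unfolding lhs_linear_def by metis
    qed
    then show ?thesis unfolding lhs_linear_def by blast
  qed
  moreover have "vars ?Q \<subseteq> vars Q" using e by (force simp: vars_def)
  moreover have "flex_body t \<and> sim (sapp \<psi> t) (sapp \<psi> s)" using inv e by (force simp: ve_inv_def)
  ultimately show "ve_inv A V \<psi>\<^sub>0 ?Q \<phi> \<psi>" using inv by (auto simp: ve_inv_def)
  have "ve_size \<psi> ?Q \<le> sz (sapp \<psi> t) + ve_size \<psi> (Q - {e})"
    using sum_Un_le[of "{(t, s)}" "Q - {e}" "\<lambda>e. sz (sapp \<psi> (fst e))"] fin by (simp add: ve_size_def)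
  then show "ve_size \<psi> ?Q < ve_size \<psi> Q" using ve_size_remove[OF fin e(2), of \<psi>] e(1) by simp
qed

text \<open>\<open>\<psi>'\<close> equals \<open>\<psi>\<close> on all variables in scope, so the
  equations carried over remain solved and keep their sizes; only the replaced equation has to be
  accounted for.\<close>

lemma ve_inv_ve1:
  assumes inv: "ve_inv A V \<psi>\<^sub>0 Q \<phi> \<psi>"
    and e: "e = (Ap (FV F) xs, Ap a ss)" "e \<in> Q"
    and a: "(\<exists>c. a = C c) \<or> (\<exists>j S. a = BV j S \<and> Ap a [] \<in> set xs)"
    and Hs: "length Hs = length ss" "distinct Hs" "\<forall>H\<in>set Hs. H \<notin> A \<union> cvars Q \<phi>"
      "\<forall>i<length ss. snd (Hs ! i) = arrows (map typeof xs) (argtys (headty a) ! i)"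
    and E: "E = (\<lambda>i. eta_app (Hs ! i) xs (argtys (headty a) ! i))"
    and \<theta>: "\<theta> = single F (abstr (argtys (snd F)) xs (Ap a (map E [0..<length ss])))"
    and Q': "Q' = set (map (\<lambda>i. (E i, ss ! i)) [0..<length ss]) \<union> (Q - {e})"
  shows "\<exists>\<psi>'. ve_inv A V \<psi>\<^sub>0 Q' (comp \<phi> \<theta>) \<psi>' \<and> ve_size \<psi>' Q' < ve_size \<psi> Q"
proof -
  let ?S = "A \<union> cvars Q \<phi>"
  have fin: "finite Q" and s\<phi>: "is_subst \<phi>" and s\<psi>: "is_subst \<psi>" and lin: "lhs_linear Q"
    and wtQ: "wt Q" using inv by (simp_all add: ve_inv_def)
  obtain \<Gamma> T where pat: "hopat \<Gamma> (Ap (FV F) xs) T" "hopat \<Gamma> (Ap a ss) T"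
    using inv e by (force simp: ve_inv_def wt_def)
  have sim_e: "sim (sapp \<psi> (Ap (FV F) xs)) (sapp \<psi> (Ap a ss))" using inv e by (force simp: ve_inv_def)
  note step = ve1_step[OF pat s\<psi> sim_e a Hs E \<theta>]
  obtain \<psi>' where s': "is_subst \<psi>'" and cov: "\<forall>X\<in>?S. sim (sapp \<psi>' (\<theta> X)) (\<psi> X)"
    and agree: "\<forall>X\<in>?S. \<psi>' X = \<psi> X"
    and simE: "\<forall>i<length ss. sim (sapp \<psi>' (E i)) (sapp \<psi> (ss ! i))"
    and less: "(\<Sum>i<length ss. sz (sapp \<psi>' (E i))) < sz (sapp \<psi> (Ap (FV F) xs))"
    using step(3) by blast
  have E': "hopat \<Gamma> (E i) (argtys (headty a) ! i)" "hopat \<Gamma> (ss ! i) (argtys (headty a) ! i)"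
    "fv (E i) = {Hs ! i}" if "i < length ss" for i
    using step(2)[OF that] by auto
  have vQ: "vars Q \<subseteq> ?S" by (auto simp: cvars_alt)
  have eq: "sapp \<psi>' t = sapp \<psi> t" if "hopat \<Delta> t U" "fv t \<subseteq> ?S" for t \<Delta> U
    by (rule sapp_cong[OF that(1)]) (use that(2) agree in blast)
  have fv_e': "fv (fst e') \<subseteq> ?S" "fv (snd e') \<subseteq> ?S" if "e' \<in> Q" for e'
    using that vQ by (auto simp: vars_def)
  have fv_ss: "fv (ss ! i) \<subseteq> fv (snd e)" if "i < length ss" for i
    using that e(1) by auto
  have eqQ: "sapp \<psi>' (fst e') = sapp \<psi> (fst e')" "sapp \<psi>' (snd e') = sapp \<psi> (snd e')" if e': "e' \<in> Q" for e'
  proof -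
    obtain \<Delta> U where p: "hopat \<Delta> (fst e') U" "hopat \<Delta> (snd e') U" using wtQ e' unfolding wt_def by blast
    show "sapp \<psi>' (fst e') = sapp \<psi> (fst e')" by (rule eq[OF p(1) fv_e'(1)[OF e']])
    show "sapp \<psi>' (snd e') = sapp \<psi> (snd e')" by (rule eq[OF p(2) fv_e'(2)[OF e']])
  qed
  have Q'_cases: "e' \<in> Q' \<longleftrightarrow> (\<exists>i<length ss. e' = (E i, ss ! i)) \<or> (e' \<in> Q \<and> e' \<noteq> e)" for e'
    by (auto simp: Q')
  have Hs_fresh: "Hs ! i \<notin> ?S" if "i < length ss" for i using Hs(1,3) that by auto
  have lhs_e: "fv (fst e) = {F}"
    using pat(1) e(1) by (auto elim!: hopat_flexE simp del: fv.simps)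
  have "F \<in> vars Q" using e lhs_e by (force simp: vars_def)
  have "wt Q'" unfolding wt_def
  proof
    fix e' assume "e' \<in> Q'"
    then consider i where "i < length ss" "e' = (E i, ss ! i)" | "e' \<in> Q" unfolding Q'_cases by blast
    then show "\<exists>\<Gamma> T. hopat \<Gamma> (fst e') T \<and> hopat \<Gamma> (snd e') T"
    proof cases
      case 1
      then show ?thesis using E'(1,2)[of i] by auto
    next
      case 2
      then show ?thesis using wtQ by (simp add: wt_def)
    qed
  qed
  moreover have "lhs_linear Q'"
    unfolding lhs_linear_def
  proof (intro ballI)
    fix e1 e2 assume "e1 \<in> Q'" "e2 \<in> Q'"
    then consider (1) i j where "i < length ss" "j < length ss" "e1 = (E i, ss ! i)" "e2 = (E j, ss ! j)"
      | (2) i where "i < length ss" "e1 = (E i, ss ! i)" "e2 \<in> Q" "e2 \<noteq> e"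
      | (3) j where "j < length ss" "e2 = (E j, ss ! j)" "e1 \<in> Q" "e1 \<noteq> e"
      | (4) "e1 \<in> Q" "e2 \<in> Q"
      unfolding Q'_cases by blast
    then show "fv (fst e1) \<inter> fv (snd e2) = {} \<and> (e1 \<noteq> e2 \<longrightarrow> fv (fst e1) \<inter> fv (fst e2) = {})"
    proof cases
      case 1
      then have "Hs ! i \<notin> fv (ss ! j)" using Hs_fresh fv_ss fv_e'(2)[OF e(2)] by blast
      moreover have "Hs ! i = Hs ! j \<longrightarrow> i = j" using 1 Hs(1,2) by (simp add: nth_eq_iff_index_eq)
      ultimately show ?thesis using 1(3,4) E'(3)[OF 1(1)] E'(3)[OF 1(2)] by auto
    next
      case 2
      then show ?thesis using E'(3)[OF 2(1)] Hs_fresh[OF 2(1)] fv_e'[OF 2(3)] by auto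
    next
      case 3
      then have "fv (fst e1) \<inter> fv (snd e) = {}" using lin e(2) by (simp add: lhs_linear_def)
      then show ?thesis using 3(2) E'(3)[OF 3(1)] Hs_fresh[OF 3(1)] fv_e'[OF 3(3)] fv_ss[OF 3(1)] by auto
    next
      case 4
      then show ?thesis using lin by (simp add: lhs_linear_def)
    qed
  qed
  moreover have "flex_body (fst e') \<and> sim (sapp \<psi>' (fst e')) (sapp \<psi>' (snd e'))" if e': "e' \<in> Q'" for e'
  proof (cases "e' \<in> Q")
    case True
    then show ?thesis using inv eqQ[OF True] by (simp add: ve_inv_def)
  next
    case False
    then obtain i where i: "i < length ss" "e' = (E i, ss ! i)" using e' Q'_cases by blast
    have "sapp \<psi>' (ss ! i) = sapp \<psi> (ss ! i)"
      by (rule eq[OF E'(2)[OF i(1)]]) (use fv_ss[OF i(1)] fv_e'(2)[OF e(2)] in blast)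
    then show ?thesis using i simE by (simp add: E flex_body_eta_app)
  qed
  moreover have "sim (sapp \<psi>' (comp \<phi> \<theta> X)) (\<psi>\<^sub>0 X)" if "X \<in> A" for X
    by (rule sim_comp[OF s\<phi> step(1) s' s\<psi> cov that]) (use inv that in \<open>simp add: ve_inv_def\<close>)
  moreover have "comp \<phi> \<theta> X = eta_var X" if "X \<in> A - V" for X
  proof -
    \<comment> \<open>\<open>F\<close> occurs in \<open>Q\<close>, so if it lies in \<open>A\<close>
      it already lies in \<open>V\<close>.\<close>
    have "X \<noteq> F" using that \<open>F \<in> vars Q\<close> inv by (auto simp: ve_inv_def)
    then have "\<theta> X = eta_var X" by (simp add: \<theta> single_def)
    then show ?thesis using that inv sapp_eta_var[OF is_substD[OF step(1)], of X]
      by (simp add: comp_def ve_inv_def)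
  qed
  moreover have "vars Q' \<inter> A \<subseteq> V"
  proof
    fix X assume X: "X \<in> vars Q' \<inter> A"
    then obtain e' where e': "e' \<in> Q'" "X \<in> fv (fst e') \<union> fv (snd e')" by (auto simp: vars_def)
    have "X \<in> vars Q"
    proof (cases "e' \<in> Q")
      case True
      then show ?thesis using e'(2) by (auto simp: vars_def)
    next
      case False
      then obtain i where i: "i < length ss" "e' = (E i, ss ! i)" using e'(1) Q'_cases by blast
      have "X \<noteq> Hs ! i" using X Hs_fresh[OF i(1)] by auto
      then have "X \<in> fv (snd e)" using e'(2) i E'(3)[OF i(1)] fv_ss[OF i(1)] by auto
      then show ?thesis using e(2) by (auto simp: vars_def)
    qed
    then show "X \<in> V" using X inv by (auto simp: ve_inv_def)
  qed
  moreover have "finite Q'" using fin by (simp add: Q')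
  ultimately have "ve_inv A V \<psi>\<^sub>0 Q' (comp \<phi> \<theta>) \<psi>'"
    using is_subst_comp[OF s\<phi> step(1)] s' unfolding ve_inv_def by blast
  moreover have "ve_size \<psi>' Q' < ve_size \<psi> Q"
  proof -
    let ?f = "\<lambda>e. sz (sapp \<psi>' (fst e))"
    have "ve_size \<psi>' Q' \<le> sum ?f (set (map (\<lambda>i. (E i, ss ! i)) [0..<length ss])) + sum ?f (Q - {e})"
      unfolding ve_size_def Q' by (rule sum_Un_le) (use fin in auto)
    also have "sum ?f (set (map (\<lambda>i. (E i, ss ! i)) [0..<length ss])) \<le> (\<Sum>i<length ss. sz (sapp \<psi>' (E i)))"
      using sum_image_le_nat[of "{..<length ss}" ?f "\<lambda>i. (E i, ss ! i)"] by (simp add: atLeast0LessThan)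
    also have "sum ?f (Q - {e}) = ve_size \<psi> (Q - {e})"
      unfolding ve_size_def by (rule sum.cong) (auto simp: eqQ)
    finally show ?thesis using less ve_size_remove[OF fin e(2), of \<psi>] e(1) by simp
  qed
  ultimately show ?thesis by blast
qed

text \<open>Here the binding is applied to the rest, but linearity keeps \<open>F\<close> and
  \<open>G\<close> out of the other left-hand sides. Those stay literally unchanged, hence flexible
  and disjoint, and \<open>H\<close> enters right-hand sides only.\<close>

lemma ve_inv_ve2:
  assumes inv: "ve_inv A V \<psi>\<^sub>0 Q \<phi> \<psi>"
    and e: "e = (Ap (FV F) xs, Ap (FV G) ys)" "e \<in> Q" "F \<noteq> G"
    and zs: "zs = filter (\<lambda>x. x \<in> set ys) xs"
    and H: "H \<notin> A \<union> cvars Q \<phi>" "snd H = arrows (map typeof zs) (resty (snd F))"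
    and \<theta>: "\<theta> = (eta_var(F := abstr (argtys (snd F)) xs (Ap (FV H) zs),
                          G := abstr (argtys (snd G)) ys (Ap (FV H) zs)))"
  shows "\<exists>\<psi>'. ve_inv A V \<psi>\<^sub>0 (Papp \<theta> (Q - {e})) (comp \<phi> \<theta>) \<psi>' \<and>
     ve_size \<psi>' (Papp \<theta> (Q - {e})) < ve_size \<psi> Q"
proof -
  let ?S = "A \<union> cvars Q \<phi>"
  let ?Q = "Papp \<theta> (Q - {e})"
  have fin: "finite Q" and s\<phi>: "is_subst \<phi>" and s\<psi>: "is_subst \<psi>" and lin: "lhs_linear Q"
    and wtQ: "wt Q" using inv by (simp_all add: ve_inv_def)
  obtain \<Gamma> T where pat: "hopat \<Gamma> (Ap (FV F) xs) T" "hopat \<Gamma> (Ap (FV G) ys) T"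
    using inv e by (force simp: ve_inv_def wt_def)
  have sim_e: "sim (sapp \<psi> (Ap (FV F) xs)) (sapp \<psi> (Ap (FV G) ys))" using inv e by (force simp: ve_inv_def)
  note step = ve2_step[OF pat s\<psi> sim_e e(3) zs H \<theta>]
  obtain \<psi>' where s': "is_subst \<psi>'" and cov: "\<forall>X\<in>?S. sim (sapp \<psi>' (\<theta> X)) (\<psi> X)"
    using step(2) by blast
  have fv_e: "fv (fst e) = {F}" "fv (snd e) = {G}"
    using pat e(1) by (auto elim!: hopat_flexE simp del: fv.simps)
  have FG: "F \<in> vars Q" "G \<in> vars Q" using e fv_e by (force simp: vars_def)+
  have \<theta>_id: "\<theta> X = eta_var X" if "X \<noteq> F" "X \<noteq> G" for X using that by (simp add: \<theta>)
  have fv_e': "fv (fst e') \<subseteq> ?S" "fv (snd e') \<subseteq> ?S" if "e' \<in> Q" for e'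
    using that by (auto simp: vars_def cvars_alt)
  have lhs: "sapp \<theta> (fst e') = fst e'" if "e' \<in> Q - {e}" for e'
  proof -
    obtain \<Delta> U where p: "hopat \<Delta> (fst e') U" using wtQ \<open>e' \<in> Q - {e}\<close> by (auto simp: wt_def)
    have "fv (fst e') \<inter> fv (snd e) = {}" "fv (fst e') \<inter> fv (fst e) = {}"
      using lin e(2) that unfolding lhs_linear_def by auto
    then show ?thesis using fv_e by (intro sapp_eta[OF p] \<theta>_id) auto
  qed
  have rhs: "fv (sapp \<theta> (snd e')) \<subseteq> fv (snd e') \<union> {H}" if "e' \<in> Q - {e}" for e'
  proof -
    obtain \<Delta> U where p: "hopat \<Delta> (snd e') U" using wtQ \<open>e' \<in> Q - {e}\<close> by (auto simp: wt_def)
    have "fv (\<theta> X) \<subseteq> {X, H}" for X using step(3,4) \<theta>_id by (cases "X = F \<or> X = G") auto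
    then show ?thesis using fv_sapp[OF p is_substD[OF step(1)]] by blast
  qed
  have sims: "sim (sapp \<psi>' (sapp \<theta> (fst e'))) (sapp \<psi>' (sapp \<theta> (snd e')))"
    "sim (sapp \<psi>' (sapp \<theta> (fst e'))) (sapp \<psi> (fst e'))" if e': "e' \<in> Q" for e'
  proof -
    obtain \<Delta> U where p: "hopat \<Delta> (fst e') U" "hopat \<Delta> (snd e') U" using wtQ e' by (auto simp: wt_def)
    have "sim (sapp \<psi> (fst e')) (sapp \<psi> (snd e'))" using inv e' by (simp add: ve_inv_def)
    then show "sim (sapp \<psi>' (sapp \<theta> (fst e'))) (sapp \<psi>' (sapp \<theta> (snd e')))"
      using sim_factor_eqn[OF is_substD[OF step(1)] is_substD[OF s'] is_substD[OF s\<psi>] cov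
          p(1) fv_e'(1)[OF e'] p(2) fv_e'(2)[OF e']] by blast
    show "sim (sapp \<psi>' (sapp \<theta> (fst e'))) (sapp \<psi> (fst e'))"
      using sim_factor[OF is_substD[OF step(1)] is_substD[OF s'] is_substD[OF s\<psi>] cov
          p(1) fv_e'(1)[OF e']] by blast
  qed
  have Q_cases: "e' \<in> ?Q \<longleftrightarrow> (\<exists>e1\<in>Q - {e}. e' = (fst e1, sapp \<theta> (snd e1)))" for e'
    using lhs by (auto simp: Papp_alt image_iff)
  have "wt ?Q" by (rule wt_Papp) (use wtQ step(1) in \<open>auto simp: wt_def\<close>)
  moreover have "lhs_linear ?Q"
    unfolding lhs_linear_def
  proof (intro ballI)
    fix e1 e2 assume "e1 \<in> ?Q" "e2 \<in> ?Q"
    then obtain e3 e4 where e34: "e3 \<in> Q - {e}" "e4 \<in> Q - {e}"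
      "e1 = (fst e3, sapp \<theta> (snd e3))" "e2 = (fst e4, sapp \<theta> (snd e4))"
      unfolding Q_cases by blast
    have "fv (fst e3) \<inter> fv (snd e4) = {}" "e3 \<noteq> e4 \<longrightarrow> fv (fst e3) \<inter> fv (fst e4) = {}"
      using lin e34(1,2) unfolding lhs_linear_def by auto
    moreover have "H \<notin> fv (fst e3)" using fv_e'(1)[of e3] e34(1) H(1) by blast
    ultimately show "fv (fst e1) \<inter> fv (snd e2) = {} \<and> (e1 \<noteq> e2 \<longrightarrow> fv (fst e1) \<inter> fv (fst e2) = {})"
      using rhs[OF e34(2)] e34(3,4) by auto
  qed
  moreover have "flex_body (fst e') \<and> sim (sapp \<psi>' (fst e')) (sapp \<psi>' (snd e'))" if e': "e' \<in> ?Q" for e'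
  proof -
    obtain e1 where e1: "e1 \<in> Q" "e1 \<noteq> e" "e' = (fst e1, sapp \<theta> (snd e1))" using e' Q_cases by blast
    then show ?thesis using sims(1)[OF e1(1)] lhs[of e1] inv by (simp add: ve_inv_def)
  qed
  moreover have "sim (sapp \<psi>' (comp \<phi> \<theta> X)) (\<psi>\<^sub>0 X)" if "X \<in> A" for X
    by (rule sim_comp[OF s\<phi> step(1) s' s\<psi> cov that]) (use inv that in \<open>simp add: ve_inv_def\<close>)
  moreover have "comp \<phi> \<theta> X = eta_var X" if "X \<in> A - V" for X
  proof -
    have "X \<noteq> F" "X \<noteq> G" using that FG inv by (auto simp: ve_inv_def)
    then have "\<theta> X = eta_var X" by (rule \<theta>_id)
    then show ?thesis using that inv sapp_eta_var[OF is_substD[OF step(1)], of X]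
      by (simp add: comp_def ve_inv_def)
  qed
  moreover have "vars ?Q \<inter> A \<subseteq> V"
  proof
    fix X assume X: "X \<in> vars ?Q \<inter> A"
    then obtain e' where "e' \<in> ?Q" and Xe': "X \<in> fv (fst e') \<union> fv (snd e')" by (auto simp: vars_def)
    then obtain e1 where e1: "e1 \<in> Q - {e}" "e' = (fst e1, sapp \<theta> (snd e1))" using Q_cases by blast
    have "X \<noteq> H" using X H(1) by auto
    then have "X \<in> fv (fst e1) \<union> fv (snd e1)" using Xe' e1(2) rhs[OF e1(1)] by auto
    then have "X \<in> vars Q" using e1(1) unfolding vars_def by blast
    then show "X \<in> V" using X inv by (auto simp: ve_inv_def)
  qed
  moreover have "finite ?Q" using fin by (simp add: Papp_alt)
  ultimately have "ve_inv A V \<psi>\<^sub>0 ?Q (comp \<phi> \<theta>) \<psi>'"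
    using is_subst_comp[OF s\<phi> step(1)] s' unfolding ve_inv_def by blast
  moreover have "ve_size \<psi>' ?Q < ve_size \<psi> Q"
  proof -
    have "ve_size \<psi>' ?Q \<le> (\<Sum>e\<in>Q - {e}. sz (sapp \<psi>' (sapp \<theta> (fst e))))"
      unfolding ve_size_def Papp_alt
      using sum_image_le_nat[of "Q - {e}" "\<lambda>e. sz (sapp \<psi>' (fst e))" "\<lambda>e. (sapp \<theta> (fst e), sapp \<theta> (snd e))"] fin
      by simp
    also have "\<dots> = ve_size \<psi> (Q - {e})"
      unfolding ve_size_def by (rule sum.cong) (auto dest: sims(2) simp: sim_sz)
    finally show ?thesis using ve_size_remove[OF fin e(2), of \<psi>] sz_pos[of "sapp \<psi> (fst e)"] by linarith
  qed
  ultimately show ?thesis by blast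
qed

lemma ve_inv_step:
  assumes "ve_inv A V \<psi>\<^sub>0 Q \<phi> \<psi>" "ve_step A (Q, \<phi>) (Q', \<phi>')"
  shows "\<exists>\<psi>'. ve_inv A V \<psi>\<^sub>0 Q' \<phi>' \<psi>' \<and> ve_size \<psi>' Q' < ve_size \<psi> Q"
  using assms(2)
proof cases
  case (ve_abs e T t s)
  then show ?thesis using ve_inv_abs[OF assms(1)] by blast
next
  case (ve1 e F xs a ss Hs Ts \<theta>)
  then show ?thesis
    using ve_inv_ve1[OF assms(1) ve1(2,3,5-9) refl] by blast
next
  case (ve2 e F xs G ys zs H \<theta>)
  then show ?thesis using ve_inv_ve2[OF assms(1) ve2(3,4,5,8-11)] by blast
qed

text \<open>Eta-long form lets the common type decide whether both sides are abstractions or both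
  are atoms. An equation with the same free head on both sides, for which VarElim has no rule, is
  excluded by linearity.\<close>

lemma ve_progress:
  assumes inv: "ve_inv A V \<psi>\<^sub>0 Q \<phi> \<psi>" and "Q \<noteq> {}" "finite A"
  shows "\<exists>Q' \<phi>'. ve_step A (Q, \<phi>) (Q', \<phi>')"
proof -
  from assms(2) obtain e where e: "e \<in> Q" by blast
  obtain l r where lr: "e = (l, r)" by (cases e)
  obtain \<Gamma> T where pat: "hopat \<Gamma> l T" "hopat \<Gamma> r T" using inv e lr by (force simp: ve_inv_def wt_def)
  have s\<psi>: "is_subst \<psi>" using inv by (simp add: ve_inv_def)
  have sim_e: "flex_body l" "sim (sapp \<psi> l) (sapp \<psi> r)" using inv e lr by (force simp: ve_inv_def)+
  have "finite (A \<union> cvars Q \<phi>)" using inv assms(3) by (simp add: ve_inv_def finite_cvars)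
  then obtain N where N: "\<And>n T. N \<le> n \<Longrightarrow> (n, T) \<notin> A \<union> cvars Q \<phi>" by (rule fresh_names) blast
  show ?thesis
  proof (cases T)
    case (Fun S U)
    then obtain l' r' where "l = Lam S l'" "r = Lam S r'" using pat by (metis hopat_FunE)
    then show ?thesis using ve_abs[of e S l' r' Q A \<phi>] e lr by blast
  next
    case (Base b)
    then obtain h xs a ss where "l = Ap h xs" and r: "r = Ap a ss" using pat by (metis hopat_BaseE)
    with sim_e(1) obtain F where l: "l = Ap (FV F) xs" by (cases h) auto
    have xs: "\<forall>x\<in>set xs. is_bvatom x" using pat(1) unfolding l by (auto elim!: hopat_flexE)
    show ?thesis
    proof (cases "\<exists>G. a = FV G")
      case True
      then obtain G where G: "a = FV G" by blast
      have "lhs_linear Q" using inv by (simp add: ve_inv_def)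
      then have "fv (fst e) \<inter> fv (snd e) = {}" using e unfolding lhs_linear_def by blast
      then have "fv l \<inter> fv r = {}" using lr by simp
      then have "F \<noteq> G" using l r G by auto
      moreover have "\<forall>y\<in>set ss. is_bvatom y" using pat(2) unfolding r G by (auto elim!: hopat_flexE)
      ultimately show ?thesis
        using ve2[of e F xs G ss Q _ "(N, arrows (map typeof (filter (\<lambda>x. x \<in> set ss) xs)) (resty (snd F)))" A \<phi>,
            OF _ e _ xs _ refl N[OF order_refl] _ refl] lr l r G by auto
    next
      case False
      have a: "(\<exists>c. a = C c) \<or> (\<exists>j S. a = BV j S \<and> Ap a [] \<in> set xs)"
        by (rule head_in_args[OF pat[unfolded l r] _ s\<psi> sim_e(2)[unfolded l r]]) (use False in blast)
      \<comment> \<open>The names \<open>N + i\<close> keep the variables apart even where their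
        types coincide.\<close>
      define Hs where "Hs = map (\<lambda>i. (N + i, arrows (map typeof xs) (argtys (headty a) ! i))) [0..<length ss]"
      have "ve_step A (Q, \<phi>)
         (set (map (\<lambda>i. (eta_app (Hs ! i) xs (argtys (headty a) ! i), ss ! i)) [0..<length ss]) \<union> (Q - {e}),
          comp \<phi> (single F (abstr (argtys (snd F)) xs
            (Ap a (map (\<lambda>i. eta_app (Hs ! i) xs (argtys (headty a) ! i)) [0..<length ss])))))"
      proof (rule ve1[OF _ e xs a _ _ _ _ refl refl refl])
        show "e = (Ap (FV F) xs, Ap a ss)" using lr l r by simp
        show "distinct Hs" by (simp add: Hs_def distinct_map inj_on_def)
        show "\<forall>H\<in>set Hs. H \<notin> A \<union> cvars Q \<phi>" using N by (fastforce simp: Hs_def)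
      qed (simp_all add: Hs_def)
      then show ?thesis by blast
    qed
  qed
qed

text \<open>The side condition of LF asks for one completed run; the run actually taken is covered
  by \<open>ve_inv_steps\<close>.\<close>

lemma ve_terminates:
  assumes "ve_inv A V \<psi>\<^sub>0 Q \<phi> \<psi>" "finite A"
  shows "\<exists>\<phi>'. (ve_step A)\<^sup>*\<^sup>* (Q, \<phi>) ({}, \<phi>')"
  using assms(1)
proof (induction "ve_size \<psi> Q" arbitrary: Q \<phi> \<psi> rule: less_induct)
  case less
  show ?case
  proof (cases "Q = {}")
    case False
    then obtain Q' \<phi>' where st: "ve_step A (Q, \<phi>) (Q', \<phi>')" using ve_progress[OF less.prems _ assms(2)] by blast
    then obtain \<psi>' where "ve_inv A V \<psi>\<^sub>0 Q' \<phi>' \<psi>'" "ve_size \<psi>' Q' < ve_size \<psi> Q"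
      using ve_inv_step[OF less.prems] by blast
    then show ?thesis using less.hyps st by (meson converse_rtranclp_into_rtranclp)
  qed auto
qed

lemma ve_inv_steps:
  assumes "(ve_step A)\<^sup>*\<^sup>* (Q, \<phi>) (Q', \<phi>')" "ve_inv A V \<psi>\<^sub>0 Q \<phi> \<psi>"
  shows "\<exists>\<psi>'. ve_inv A V \<psi>\<^sub>0 Q' \<phi>' \<psi>'"
  using assms
proof (induction arbitrary: rule: rtranclp_induct2)
  case (step Q1 \<phi>1 Q2 \<phi>2)
  then show ?case using ve_inv_step by blast
qed auto

text \<open>The condition \<open>F \<notin> fv u\<close> of LF is exactly linearity of the initial
  problem.\<close>

lemma ve_inv_init:
  assumes "hopat \<Gamma> (Ap (FV F) xs) T" "hopat \<Gamma> u T" "is_subst \<psi>"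
    "sim (sapp \<psi> (Ap (FV F) xs)) (sapp \<psi> u)" "F \<notin> fv u"
  shows "ve_inv A ({F} \<union> fv u) \<psi> {(Ap (FV F) xs, u)} eps \<psi>"
proof -
  have "fv (Ap (FV F) xs) = {F}" using assms(1) by (auto elim!: hopat_flexE simp del: fv.simps)
  then show ?thesis using assms sapp_eta_var[OF is_substD[OF assms(3)]]
    unfolding ve_inv_def eps_def
    by (auto simp: is_subst_eps wt_def lhs_linear_def vars_def simp del: fv.simps sapp.simps)
qed

text \<open>The argument starts from an arbitrary result \<open>\<phi>\<close>, so the choices made
  by VarElim do not matter. On \<open>A\<close> the restriction coincides with
  \<open>\<phi>\<close>, by the last clauses of \<open>ve_inv\<close>.\<close>

lemma lf_step:
  assumes "hopat \<Gamma> (Ap (FV F) xs) T" "hopat \<Gamma> u T" "is_subst \<psi>"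
    "sim (sapp \<psi> (Ap (FV F) xs)) (sapp \<psi> u)" "F \<notin> fv u"
    "var_elim A (Ap (FV F) xs) u \<phi>" and \<theta>: "\<theta> = restrict \<phi> ({F} \<union> fv u)"
  shows "is_subst \<theta>" "\<exists>\<psi>'. is_subst \<psi>' \<and> (\<forall>X\<in>A. sim (sapp \<psi>' (\<theta> X)) (\<psi> X))"
proof -
  let ?V = "{F} \<union> fv u"
  obtain \<psi>' where inv: "ve_inv A ?V \<psi> {} \<phi> \<psi>'"
    using ve_inv_steps[OF assms(6)[unfolded var_elim_def] ve_inv_init[OF assms(1-5)]] by blast
  have "is_subst \<phi>" using inv by (simp add: ve_inv_def)
  then show "is_subst \<theta>"
    by (intro is_subst_agree[OF is_subst_eps, of ?V])
      (simp_all add: \<theta> restrict_def wsubD is_substD)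
  have "\<theta> X = \<phi> X" if "X \<in> A" for X
    using that inv by (cases "X \<in> ?V") (simp_all add: \<theta> restrict_def ve_inv_def)
  then show "\<exists>\<psi>'. is_subst \<psi>' \<and> (\<forall>X\<in>A. sim (sapp \<psi>' (\<theta> X)) (\<psi> X))"
    using inv by (auto simp: ve_inv_def)
qed

lemma var_elim_exists:
  assumes "hopat \<Gamma> (Ap (FV F) xs) T" "hopat \<Gamma> u T" "is_subst \<psi>"
    "sim (sapp \<psi> (Ap (FV F) xs)) (sapp \<psi> u)" "F \<notin> fv u" "finite A"
  shows "\<exists>\<phi>. var_elim A (Ap (FV F) xs) u \<phi>"
  unfolding var_elim_def by (rule ve_terminates[OF ve_inv_init[OF assms(1-5)] assms(6)])

end

section \<open>The algorithm HOPSU\<close>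

lemma sum_set_le_sum_list: "sum f (set xs) \<le> (sum_list (map f xs) :: nat)"
proof (induction xs)
  case (Cons x xs)
  then show ?case by (cases "x \<in> set xs") (simp_all add: insert_absorb)
qed simp

context similarity_degree
begin

text \<open>Keeping the comparison with \<open>\<tau>\<close> on the whole avoided set
  \<open>W\<close> lets the same set serve as scope for every binding.\<close>

definition hop_inv :: "var set \<Rightarrow> subst \<Rightarrow> eqn set \<Rightarrow> subst \<Rightarrow> subst \<Rightarrow> bool" where
  "hop_inv W \<tau> P \<sigma> \<psi> \<longleftrightarrow> finite P \<and> is_subst \<sigma> \<and> is_subst \<psi> \<and> wt P \<and>
     (\<forall>e\<in>P. sim (sapp \<psi> (fst e)) (sapp \<psi> (snd e))) \<and> (\<forall>X\<in>W. sim (sapp \<psi> (\<sigma> X)) (\<tau> X))"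

text \<open>The flag decreases under Ori, which leaves the size unchanged.\<close>

definition weight :: "subst \<Rightarrow> eqn \<Rightarrow> nat" where
  "weight \<psi> e = sz (sapp \<psi> (fst e)) + of_bool (flex (snd e))"

definition hop_size :: "subst \<Rightarrow> eqn set \<Rightarrow> nat" where
  "hop_size \<psi> P = sum (weight \<psi>) P"

lemma hop_size_remove: "finite P \<Longrightarrow> e \<in> P \<Longrightarrow> hop_size \<psi> P = weight \<psi> e + hop_size \<psi> (P - {e})"
  unfolding hop_size_def by (rule sum.remove)

text \<open>Serves Abs, Dec and Ori, which bind no variable and hence keep the witness
  \<open>\<psi>\<close>.\<close>

lemma hop_inv_replace:
  assumes "hop_inv W \<tau> P \<sigma> \<psi>" "e \<in> P" "finite E" "wt E"
    "\<forall>e'\<in>E. sim (sapp \<psi> (fst e')) (sapp \<psi> (snd e'))" "sum (weight \<psi>) E < weight \<psi> e"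
  shows "hop_inv W \<tau> (E \<union> (P - {e})) \<sigma> \<psi> \<and> hop_size \<psi> (E \<union> (P - {e})) < hop_size \<psi> P"
proof
  show "hop_inv W \<tau> (E \<union> (P - {e})) \<sigma> \<psi>"
    using assms(1,3-5) unfolding hop_inv_def wt_def by blast
  have fin: "finite P" using assms(1) by (simp add: hop_inv_def)
  have "hop_size \<psi> (E \<union> (P - {e})) \<le> sum (weight \<psi>) E + hop_size \<psi> (P - {e})"
    unfolding hop_size_def by (rule sum_Un_le) (use fin assms(3) in auto)
  then show "hop_size \<psi> (E \<union> (P - {e})) < hop_size \<psi> P"
    using hop_size_remove[OF fin assms(2), of \<psi>] assms(6) by linarith
qed

text \<open>Serves SV and LF. Instances of the remaining equations change only up to similarity, so
  they keep their sizes, and the decrease comes from the discarded equation.\<close>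

lemma hop_inv_bind:
  assumes inv: "hop_inv W \<tau> P \<sigma> \<psi>" and e: "e \<in> P" and s\<theta>: "is_subst \<theta>" and s': "is_subst \<psi>'"
    and cov: "\<forall>X\<in>W \<union> cvars P \<sigma>. sim (sapp \<psi>' (\<theta> X)) (\<psi> X)"
  shows "hop_inv W \<tau> (Papp \<theta> (P - {e})) (comp \<sigma> \<theta>) \<psi>' \<and>
    hop_size \<psi>' (Papp \<theta> (P - {e})) < hop_size \<psi> P"
proof
  let ?P = "Papp \<theta> (P - {e})"
  have fin: "finite P" and s\<sigma>: "is_subst \<sigma>" and s\<psi>: "is_subst \<psi>" and wtP: "wt P"
    using inv by (simp_all add: hop_inv_def)
  note ws = is_substD[OF s\<theta>] is_substD[OF s'] is_substD[OF s\<psi>]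
  have sims: "sim (sapp \<psi>' (sapp \<theta> (fst e'))) (sapp \<psi>' (sapp \<theta> (snd e'))) \<and>
    sim (sapp \<psi>' (sapp \<theta> (fst e'))) (sapp \<psi> (fst e'))" if e': "e' \<in> P" for e'
  proof -
    obtain \<Delta> U where p: "hopat \<Delta> (fst e') U" "hopat \<Delta> (snd e') U" using wtP e' unfolding wt_def by blast
    have "fv (fst e') \<union> fv (snd e') \<subseteq> vars P" using e' unfolding vars_def by blast
    then have f: "fv (fst e') \<subseteq> W \<union> cvars P \<sigma>" "fv (snd e') \<subseteq> W \<union> cvars P \<sigma>"
      unfolding cvars_alt by blast+
    have "sim (sapp \<psi> (fst e')) (sapp \<psi> (snd e'))" using inv e' by (simp add: hop_inv_def)
    then show ?thesis using sim_factor_eqn[OF ws cov p(1) f(1) p(2) f(2)] sim_factor[OF ws cov p(1) f(1)] by blast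
  qed
  have "wt ?P" by (rule wt_Papp) (use wtP ws in \<open>auto simp: wt_def\<close>)
  moreover have "finite ?P" using fin by (simp add: Papp_alt)
  moreover have "\<forall>e'\<in>?P. sim (sapp \<psi>' (fst e')) (sapp \<psi>' (snd e'))"
    unfolding Papp_alt using sims by simp
  moreover have "sim (sapp \<psi>' (comp \<sigma> \<theta> X)) (\<tau> X)" if "X \<in> W" for X
    by (rule sim_comp[OF s\<sigma> s\<theta> s' s\<psi> cov that]) (use inv that in \<open>simp add: hop_inv_def\<close>)
  ultimately show "hop_inv W \<tau> ?P (comp \<sigma> \<theta>) \<psi>'"
    using is_subst_comp[OF s\<sigma> s\<theta>] s' unfolding hop_inv_def by blast
  have "hop_size \<psi>' ?P \<le> (\<Sum>e'\<in>P - {e}. weight \<psi>' (sapp \<theta> (fst e'), sapp \<theta> (snd e')))"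
    unfolding hop_size_def Papp_alt by (rule sum_image_le_nat) (use fin in simp)
  also have "\<dots> \<le> hop_size \<psi> (P - {e})"
    unfolding hop_size_def
  proof (rule sum_mono)
    fix e' assume "e' \<in> P - {e}"
    then have "sz (sapp \<psi>' (sapp \<theta> (fst e'))) = sz (sapp \<psi> (fst e'))" using sims sim_sz by blast
    moreover have "of_bool (flex (sapp \<theta> (snd e'))) \<le> (of_bool (flex (snd e')) :: nat)"
      using flex_sapp by auto
    ultimately show "weight \<psi>' (sapp \<theta> (fst e'), sapp \<theta> (snd e')) \<le> weight \<psi> e'"
      by (simp add: weight_def)
  qed
  also have "\<dots> < hop_size \<psi> P"
    using hop_size_remove[OF fin e, of \<psi>] by (simp add: weight_def)
  finally show "hop_size \<psi>' ?P < hop_size \<psi> P" .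
qed

lemma hstep0_inv:
  assumes inv: "hop_inv W \<tau> P \<sigma> \<psi>" and e: "e \<in> P" and \<delta>: "d \<le> \<delta>"
    and st: "hstep0 Rc \<mu> W e (P - {e}) \<sigma> \<delta> c"
  shows "\<exists>P' \<sigma>' \<delta>' \<psi>'. c = Conf P' \<sigma>' \<delta>' \<and> d \<le> \<delta>' \<and> hop_inv W \<tau> P' \<sigma>' \<psi>' \<and> hop_size \<psi>' P' < hop_size \<psi> P"
proof -
  have s\<psi>: "is_subst \<psi>" using inv by (simp add: hop_inv_def)
  have ins: "insert e (P - {e}) = P" using e by blast
  obtain \<Gamma> T where pat: "hopat \<Gamma> (fst e) T" "hopat \<Gamma> (snd e) T" using inv e unfolding hop_inv_def wt_def by blast
  have sim_e: "sim (sapp \<psi> (fst e)) (sapp \<psi> (snd e))" using inv e by (simp add: hop_inv_def)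
  show ?thesis using st
  proof cases
    case (Abs S t s)
    obtain U where U: "T = Fun S U" "hopat (S # \<Gamma>) t U"
      using pat(1) unfolding Abs(2) fst_conv by (rule hopat_LamE)
    obtain U' where "T = Fun S U'" "hopat (S # \<Gamma>) s U'"
      using pat(2) unfolding Abs(2) snd_conv by (rule hopat_LamE)
    with U have "\<exists>\<Gamma> U. hopat \<Gamma> t U \<and> hopat \<Gamma> s U" by auto
    then have "hop_inv W \<tau> ({(t, s)} \<union> (P - {e})) \<sigma> \<psi> \<and> hop_size \<psi> ({(t, s)} \<union> (P - {e})) < hop_size \<psi> P"
      using sim_e Abs(2) by (intro hop_inv_replace[OF inv e]) (auto simp: wt_def weight_def)
    then show ?thesis using Abs \<delta> by auto
  next
    case (Dec f ts g ss)
    have f: "\<And>X. f \<noteq> FV X" and g: "\<And>X. g \<noteq> FV X" using Dec(3,4) by (auto simp: rigid_def)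
    have sim': "simh f g" "list_all2 sim (map (sapp \<psi>) ts) (map (sapp \<psi>) ss)"
      using sim_e Dec(2) f g by simp_all
    obtain Ts b where ts: "rigid_in \<Gamma> f" "headty f = arrows Ts (Base b)" "length ts = length Ts"
      "\<forall>i<length ts. hopat \<Gamma> (ts ! i) (Ts ! i)" "T = Base b"
      using pat(1) f unfolding Dec(2) fst_conv by (rule hopat_rigidE)
    obtain Us c where ss: "rigid_in \<Gamma> g" "headty g = arrows Us (Base c)" "length ss = length Us"
      "\<forall>i<length ss. hopat \<Gamma> (ss ! i) (Us ! i)" "T = Base c"
      using pat(2) g unfolding Dec(2) snd_conv by (rule hopat_rigidE)
    have "Us = Ts" using simh_headty[OF sim'(1)] ts(2) ss(2)
      by (metis argtys.simps(1) argtys_arrows append_Nil2)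
    let ?E = "set (zip ts ss)"
    have "wt ?E" unfolding wt_def using ts(4) ss(4) \<open>Us = Ts\<close> by (force simp: in_set_zip)
    moreover have "\<forall>e'\<in>?E. sim (sapp \<psi> (fst e')) (sapp \<psi> (snd e'))"
      using sim'(2) by (auto simp: in_set_zip list_all2_conv_all_nth)
    moreover have "sum (weight \<psi>) ?E < weight \<psi> e"
    proof -
      have "sum (weight \<psi>) ?E \<le> sum_list (map (weight \<psi>) (zip ts ss))"
        by (rule sum_set_le_sum_list)
      also have "\<dots> \<le> sum_list (map (\<lambda>e. Suc (sz (sapp \<psi> (fst e)))) (zip ts ss))"
        by (rule sum_list_mono) (simp add: weight_def)
      also have "map (\<lambda>e. Suc (sz (sapp \<psi> (fst e)))) (zip ts ss) = map (\<lambda>t. Suc (sz (sapp \<psi> t))) ts"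
        using Dec(5) by (intro nth_equalityI) auto
      finally show ?thesis using Dec(2) f by (simp add: weight_def o_def)
    qed
    ultimately have "hop_inv W \<tau> (?E \<union> (P - {e})) \<sigma> \<psi> \<and> hop_size \<psi> (?E \<union> (P - {e})) < hop_size \<psi> P"
      by (intro hop_inv_replace[OF inv e]) auto
    \<comment> \<open>\<open>\<psi>\<close> leaves rigid heads in place, so similarity of the
      instances already bounds the similarity of \<open>f\<close> and \<open>g\<close>.\<close>
    moreover have "d \<le> min \<delta> (RA Rc f g)" using sim'(1) \<delta> by (simp add: simh_def)
    ultimately show ?thesis using Dec(1) by blast
  next
    case (SV F xs ys zs H \<theta>)
    note step = sv_step[OF pat[unfolded SV(2) fst_conv snd_conv] s\<psi> sim_e[unfolded SV(2) fst_conv snd_conv]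
        SV(6) SV(7)[unfolded ins] SV(8,9)]
    obtain \<psi>' where "is_subst \<psi>'" "\<forall>X\<in>W \<union> cvars P \<sigma>. sim (sapp \<psi>' (\<theta> X)) (\<psi> X)" using step(2) by blast
    from hop_inv_bind[OF inv e step(1) this] show ?thesis using SV(1) \<delta> by blast
  next
    case (Ori a ss F xs)
    have a: "\<And>X. a \<noteq> FV X" using Ori(4) by auto
    have "sz (sapp \<psi> (Ap (FV F) xs)) = sz (sapp \<psi> (Ap a ss))"
      using sim_sz[OF sim_e] Ori(2) by simp
    moreover have "\<not> flex (Ap a ss)" using a by (cases a) auto
    ultimately have w: "weight \<psi> (Ap (FV F) xs, Ap a ss) < weight \<psi> e"
      using Ori(2) by (simp add: weight_def)
    have "hop_inv W \<tau> ({(Ap (FV F) xs, Ap a ss)} \<union> (P - {e})) \<sigma> \<psi> \<and>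
       hop_size \<psi> ({(Ap (FV F) xs, Ap a ss)} \<union> (P - {e})) < hop_size \<psi> P"
    proof (rule hop_inv_replace[OF inv e])
      show "wt {(Ap (FV F) xs, Ap a ss)}" using pat Ori(2) by (auto simp: wt_def)
      show "\<forall>e'\<in>{(Ap (FV F) xs, Ap a ss)}. sim (sapp \<psi> (fst e')) (sapp \<psi> (snd e'))"
        using sim_sym[OF sim_e] Ori(2) by simp
    qed (use w in simp_all)
    then show ?thesis using Ori(1) \<delta> by auto
  next
    case (LF F xs u a ss \<phi> \<theta>)
    note step = lf_step[OF pat[unfolded LF(2) fst_conv snd_conv] s\<psi> sim_e[unfolded LF(2) fst_conv snd_conv]
        LF(5) LF(7)[unfolded ins] LF(8)]
    obtain \<psi>' where "is_subst \<psi>'" "\<forall>X\<in>W \<union> cvars P \<sigma>. sim (sapp \<psi>' (\<theta> X)) (\<psi> X)" using step(2) by blast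
    from hop_inv_bind[OF inv e step(1) this] show ?thesis using LF(1) \<delta> by blast
  qed
qed

text \<open>On base type the heads decide: two rigid ones allow Dec, rigid against flexible Ori,
  flexible against rigid LF, and two flexible ones SV or LF according to whether they are
  equal.\<close>

lemma hstep0_progress:
  assumes inv: "hop_inv W \<tau> P \<sigma> \<psi>" and e: "e \<in> P" and \<delta>: "d \<le> \<delta>" "\<mu> \<le> d" and "finite W"
  shows "\<exists>c. hstep0 Rc \<mu> W e (P - {e}) \<sigma> \<delta> c"
proof -
  have s\<psi>: "is_subst \<psi>" and s\<sigma>: "is_subst \<sigma>" and fin: "finite P" using inv by (simp_all add: hop_inv_def)
  have ins: "insert e (P - {e}) = P" using e by blast
  obtain l r where lr: "e = (l, r)" by (cases e)
  obtain \<Gamma> T where pat: "hopat \<Gamma> l T" "hopat \<Gamma> r T"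
    using inv e unfolding hop_inv_def wt_def lr by fastforce
  have sim_e: "sim (sapp \<psi> l) (sapp \<psi> r)" using inv e unfolding hop_inv_def lr by fastforce
  let ?S = "W \<union> cvars (insert e (P - {e})) \<sigma>"
  have finS: "finite ?S" using assms(5) finite_cvars[OF fin s\<sigma>] ins by simp
  then obtain N where N: "\<And>n T. N \<le> n \<Longrightarrow> (n, T) \<notin> ?S" by (rule fresh_names) blast
  show ?thesis
  proof (cases T)
    case (Fun S U)
    then obtain l' r' where "l = Lam S l'" "r = Lam S r'" using pat by (metis hopat_FunE)
    then show ?thesis using hstep0.Abs lr by blast
  next
    case (Base b)
    then obtain h ts a ss where l: "l = Ap h ts" and r: "r = Ap a ss" using pat by (metis hopat_BaseE)
    consider (rr) "\<And>X. h \<noteq> FV X" "\<And>X. a \<noteq> FV X" | (rf) F where "\<And>X. h \<noteq> FV X" "a = FV F"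
      | (fr) F where "h = FV F" "\<And>X. a \<noteq> FV X" | (ff) F G where "h = FV F" "a = FV G" by blast
    then show ?thesis
    proof cases
      case rr
      then have "rigid h" "rigid a" unfolding rigid_def by (metis hd.exhaust)+
      moreover have "simh h a" "length ts = length ss"
        using sim_e l r rr by (auto dest: list_all2_lengthD)
      \<comment> \<open>Dec passes the cut because the accumulated degree and the similarity of the
        heads are both at least \<open>d\<close>.\<close>
      moreover from this(1) have "\<mu> \<le> min \<delta> (RA Rc h a)" using \<delta> by (simp add: simh_def)
      ultimately show ?thesis using lr l r by (blast intro: hstep0.Dec)
    next
      case rf
      have "(\<exists>c. h = C c) \<or> (\<exists>j S. h = BV j S \<and> Ap h [] \<in> set ss)"
        by (rule head_in_args[OF _ _ rf(1) s\<psi>]) (use pat sim_sym[OF sim_e] l r rf(2) in auto)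
      moreover have "\<forall>x\<in>set ss. is_bvatom x" using pat(2) unfolding r rf by (auto elim!: hopat_flexE)
      ultimately show ?thesis using hstep0.Ori[of e h ts F ss] lr l r rf(2) by blast
    next
      case fr
      have F: "F \<notin> fv r"
        unfolding r by (rule not_sim_occurs[OF _ _ fr(2) is_substD[OF s\<psi>]]) (use pat sim_e l r fr(1) in auto)
      have "(\<exists>c. a = C c) \<or> (\<exists>j S. a = BV j S \<and> Ap a [] \<in> set ts)"
        by (rule head_in_args[OF _ _ fr(2) s\<psi>]) (use pat sim_e l r fr(1) in auto)
      moreover have "\<forall>x\<in>set ts. is_bvatom x" using pat(1) unfolding l fr by (auto elim!: hopat_flexE)
      moreover obtain \<phi> where "var_elim ?S (Ap (FV F) ts) r \<phi>"
        using var_elim_exists[OF pat[unfolded l fr(1)] s\<psi> sim_e[unfolded l fr(1)] F finS] by blast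
      ultimately show ?thesis using hstep0.LF[of e F ts r a ss] F lr l r fr(1) by blast
    next
      case ff
      have b: "\<forall>x\<in>set ts. is_bvatom x" "\<forall>x\<in>set ss. is_bvatom x"
        using pat unfolding l r ff by (auto elim!: hopat_flexE)
      show ?thesis
      proof (cases "F = G")
        case True
        have len: "length xs = length (argtys (snd X))" if "hopat \<Gamma> (Ap (FV X) xs) T" for X xs
          using that by (rule hopat_flexE) simp
        have "length ts = length ss"
          using len[OF pat(1)[unfolded l ff]] len[OF pat(2)[unfolded r ff]] True by simp
        then show ?thesis
          using hstep0.SV[of e F ts ss _ "(N, arrows (map typeof (map fst (filter (\<lambda>(x, y). x = y) (zip ts ss)))) (resty (snd F)))"
              W "P - {e}" \<sigma> _ Rc \<mu> \<delta>, OF _ _ b refl N[OF order_refl] _ refl] lr l r ff True by auto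
      next
        case False
        have F: "F \<notin> fv r" using pat(2) False unfolding r ff by (auto elim!: hopat_flexE simp del: fv.simps)
        moreover obtain \<phi> where "var_elim ?S (Ap (FV F) ts) r \<phi>"
          using var_elim_exists[OF pat[unfolded l ff(1)] s\<psi> sim_e[unfolded l ff(1)] F finS] by blast
        ultimately show ?thesis using hstep0.LF[of e F ts r a ss] b lr l r ff by blast
      qed
    qed
  qed
qed

lemma hstep_inv:
  assumes "hop_inv W \<tau> P \<sigma> \<psi>" "d \<le> \<delta>" "\<mu> \<le> d" "finite W" "hstep Rc \<mu> W (Conf P \<sigma> \<delta>) c"
  shows "\<exists>P' \<sigma>' \<delta>' \<psi>'. c = Conf P' \<sigma>' \<delta>' \<and> d \<le> \<delta>' \<and> hop_inv W \<tau> P' \<sigma>' \<psi>' \<and> hop_size \<psi>' P' < hop_size \<psi> P"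
  using assms(5)
proof cases
  case (rule e)
  then show ?thesis using hstep0_inv[OF assms(1) _ assms(2)] by blast
next
  case (Fail e)
  then show ?thesis using hstep0_progress[OF assms(1) _ assms(2-4)] by blast
qed

text \<open>The measure depends on \<open>\<psi>\<close>, which is not part of a configuration. The
  induction therefore generalises over the witness and passes to the shifted run.\<close>

lemma no_infinite_run:
  assumes "hop_inv W \<tau> P \<sigma> \<psi>" "d \<le> \<delta>" "\<mu> \<le> d" "finite W"
    "f 0 = Conf P \<sigma> \<delta>" "\<forall>i. hstep Rc \<mu> W (f i) (f (Suc i))"
  shows False
  using assms
proof (induction "hop_size \<psi> P" arbitrary: P \<sigma> \<psi> \<delta> f rule: less_induct)
  case less
  have "hstep Rc \<mu> W (Conf P \<sigma> \<delta>) (f (Suc 0))" using less.prems(5,6) by metis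
  then obtain P' \<sigma>' \<delta>' \<psi>' where *: "f (Suc 0) = Conf P' \<sigma>' \<delta>'" "d \<le> \<delta>'" "hop_inv W \<tau> P' \<sigma>' \<psi>'"
    "hop_size \<psi>' P' < hop_size \<psi> P"
    using hstep_inv[OF less.prems(1-4)] by blast
  show False
    by (rule less.hyps[OF *(4,3,2) less.prems(3,4), of "\<lambda>i. f (Suc i)"]) (use *(1) less.prems(6) in auto)
qed

lemma hstep_inv_steps:
  assumes "(hstep Rc \<mu> W)\<^sup>*\<^sup>* (Conf P \<sigma> \<delta>) c" "hop_inv W \<tau> P \<sigma> \<psi>" "d \<le> \<delta>" "\<mu> \<le> d" "finite W"
  shows "\<exists>P' \<sigma>' \<delta>' \<psi>'. c = Conf P' \<sigma>' \<delta>' \<and> d \<le> \<delta>' \<and> hop_inv W \<tau> P' \<sigma>' \<psi>'"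
  using assms(1)
proof induction
  case base
  then show ?case using assms by blast
next
  case (step c c')
  then show ?case using hstep_inv[OF _ _ assms(4,5)] by blast
qed

end

theorem theorem4:
  fixes Rc :: "const \<Rightarrow> const \<Rightarrow> real" and \<mu> :: real
    and t s :: trm and T :: ty and \<tau> :: subst and d\<tau> :: real and W :: "var set"
  assumes "similarity Rc" and "0 < \<mu>" and "\<mu> \<le> 1"
    and "hopat [] t T" and "hopat [] s T"
    and "is_subst \<tau>" and "unifier_deg Rc \<mu> \<tau> t s d\<tau>"
    and "finite W" and "fv t \<union> fv s \<union> Dom \<tau> \<subseteq> W"
  shows "terminates (hstep Rc \<mu> W) (Conf {(t, s)} eps 1) \<and>
         (\<forall>c. (hstep Rc \<mu> W)\<^sup>*\<^sup>* (Conf {(t, s)} eps 1) c \<and> final (hstep Rc \<mu> W) c \<longrightarrow>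
              (\<exists>\<sigma> d. c = Conf {} \<sigma> d \<and> more_general Rc \<mu> (Dom \<tau>) \<sigma> \<tau> \<and> d \<ge> d\<tau>))"
proof -
  have d: "Rt Rc (sapp \<tau> t) (sapp \<tau> s) = d\<tau>" "\<mu> \<le> d\<tau>" using assms(7) by (auto simp: unifier_deg_def)
  then have d1: "d\<tau> \<le> 1" using Rt_le_1(1)[OF assms(1)] by metis
  \<comment> \<open>With the degree of \<open>\<tau>\<close> as threshold, the invariant yields the
    bound on the computed degree directly.\<close>
  interpret similarity_degree Rc d\<tau>
    by standard (use assms(1,2) d d1 in auto)
  have "wt {(t, s)}" using assms(4,5) by (auto simp: wt_def)
  \<comment> \<open>The first witness is \<open>\<tau>\<close> itself, since instantiating the
    identity \<open>eps\<close> by \<open>\<tau>\<close> gives \<open>\<tau>\<close> back.\<close>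
  then have inv: "hop_inv W \<tau> {(t, s)} eps \<tau>"
    using assms(6) d(1) sapp_eta_var[OF is_substD[OF assms(6)]]
    by (simp add: hop_inv_def eps_def is_subst_eps sim_def[of "sapp \<tau> t"])
  have "terminates (hstep Rc \<mu> W) (Conf {(t, s)} eps 1)"
    unfolding terminates_def using no_infinite_run[OF inv d1 d(2) assms(8)] by blast
  moreover have "\<exists>\<sigma> d. c = Conf {} \<sigma> d \<and> more_general Rc \<mu> (Dom \<tau>) \<sigma> \<tau> \<and> d \<ge> d\<tau>"
    if run: "(hstep Rc \<mu> W)\<^sup>*\<^sup>* (Conf {(t, s)} eps 1) c" and fin: "final (hstep Rc \<mu> W) c" for c
  proof -
    obtain P \<sigma> \<delta> \<psi> where c: "c = Conf P \<sigma> \<delta>" "d\<tau> \<le> \<delta>" "hop_inv W \<tau> P \<sigma> \<psi>"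
      using hstep_inv_steps[OF run inv d1 d(2) assms(8)] by blast
    have "P = {}"
    proof (rule ccontr)
      assume "P \<noteq> {}"
      then obtain e where "e \<in> P" by blast
      \<comment> \<open>A selected equation always admits a step, if need be Fail, so a final
        configuration can have none left.\<close>
      then have "\<exists>c'. hstep Rc \<mu> W c c'" unfolding c(1) by (blast intro: hstep.intros)
      then show False using fin by (simp add: final_def)
    qed
    moreover have "more_general Rc \<mu> (Dom \<tau>) \<sigma> \<tau>"
      unfolding more_general_def
    proof (intro exI conjI ballI)
      show "is_subst \<psi>" using c(3) by (simp add: hop_inv_def)
      fix X assume "X \<in> Dom \<tau>"
      then have "sim (sapp \<psi> (\<sigma> X)) (\<tau> X)" using c(3) assms(9) unfolding hop_inv_def by blast
      then show "\<mu> \<le> Rt Rc (sapp \<psi> (\<sigma> X)) (\<tau> X)" using d(2) unfolding sim_def by linarith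
    qed
    ultimately show ?thesis using c(1,2) by blast
  qed
  ultimately show ?thesis by blast
qed

end
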